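(* Suppose $n\ge3$ and let $r_1,\dots,r_n>0$. If the inequality $$\Big(1+\sum_{l=1}^nr_l^2\Big)^{1/2}r_i\ge r_jr_k$$ is not satisfied for some distinct $i,j,k\in\{1,\dots,n\}$, or if $N(r_1,\dots,r_n):=\sharp\{r_1,\dots,r_n\}\ge3$, then the torus $\Phi^{-1}(T(r_1,\dots,r_n))$ is not Hamiltonian volume minimizing in $\mathbb{C}H^n$.
   Context: $\mathbb{C}H^n$ is the unit ball $B^n=\{z\in\mathbb{C}^n:|z|<1\}$ with the standard complex structure $J$, Kähler form $\omega=-\frac{\sqrt{-1}}{2}\partial\overline\partial\log(1-|z|^2)$ and metric $g=\omega(\cdot,J\cdot)$ (constant holomorphic sectional curvature $-4$). $\Phi:B^n\to\mathbb{C}^n$, $\Phi(z)=(1-|z|^2)^{-1/2}z$, is a symplectic diffeomorphism onto $\mathbb{C}^n$ with its standard symplectic form. $T(r_1,\dots,r_n)=\{(r_1e^{\sqrt{-1}\theta_1},\dots,r_ne^{\sqrt{-1}\theta_n}):\theta_i\in\mathbb{R}\}\subset\mathbb{C}^n$. $\sharp\{r_1,\dots,r_n\}$ is the number of distinct values among the $r_i$. $\mathrm{Ham}_c(M,\omega)$ is the set of time-one maps of flows of time-dependent Hamiltonian vector fields generated by compactly supported functions $f_t\in C_c^\infty([0,1]\times M)$. A Lagrangian submanifold $L$ of $(M,\omega,J,g)$ is Hamiltonian volume minimizing if $\mathrm{Vol}_g(\Psi(L))\ge\mathrm{Vol}_g(L)$ for every $\Psi\in\mathrm{Ham}_c(M,\omega)$.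 *)

theory Defs
  imports "HOL-Analysis.Analysis"
begin

primrec C_k_on :: "nat \<Rightarrow> 'a::euclidean_space set \<Rightarrow> ('a \<Rightarrow> 'b::real_normed_vector) \<Rightarrow> bool"
  where
    "C_k_on 0 U f \<longleftrightarrow> continuous_on U f"
  | "C_k_on (Suc k) U f \<longleftrightarrow>
       f differentiable_on U \<and> (\<forall>v. C_k_on k U (\<lambda>x. frechet_derivative f (at x) v))"

text \<open>\<open>C_k_on\<close> is meant for open sets. On an arbitrary set, such as \<open>[0,1] \<times> B\<^sup>n\<close>, smoothness
  means that locally there are smooth extensions to open sets.\<close>

definition smooth_on :: "'a::euclidean_space set \<Rightarrow> ('a \<Rightarrow> 'b::real_normed_vector) \<Rightarrow> bool" where
  "smooth_on S f \<longleftrightarrow>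
     (\<forall>x\<in>S. \<exists>U F. open U \<and> x \<in> U \<and> (\<forall>k. C_k_on k U F) \<and> (\<forall>y\<in>S \<inter> U. F y = f y))"

text \<open>Complex hyperbolic space is the unit ball \<open>ball 0 1\<close> of \<open>complex ^ 'n\<close>; all tangent spaces
  are identified with \<open>complex ^ 'n\<close>.\<close>

definition wirtinger :: "'n::finite \<Rightarrow> (complex ^ 'n \<Rightarrow> complex) \<Rightarrow> complex ^ 'n \<Rightarrow> complex" where
  "wirtinger j f z =
     (frechet_derivative f (at z) (axis j 1) - \<i> * frechet_derivative f (at z) (axis j \<i>)) / 2"

definition wirtinger_bar :: "'n::finite \<Rightarrow> (complex ^ 'n \<Rightarrow> complex) \<Rightarrow> complex ^ 'n \<Rightarrow> complex" where
  "wirtinger_bar j f z =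
     (frechet_derivative f (at z) (axis j 1) + \<i> * frechet_derivative f (at z) (axis j \<i>)) / 2"

text \<open>The two-form \<open>\<partial>\<partial>bar f = (\<Sum>j k. (\<partial>\<^sub>j \<partial>bar\<^sub>k f) dz\<^sub>j \<and> dzbar\<^sub>k)\<close>, with the convention
  \<open>(\<alpha> \<and> \<beta>)(u,v) = \<alpha>(u) \<beta>(v) - \<alpha>(v) \<beta>(u)\<close>.\<close>

definition del_delbar ::
  "(complex ^ 'n::finite \<Rightarrow> complex) \<Rightarrow> complex ^ 'n \<Rightarrow> complex ^ 'n \<Rightarrow> complex ^ 'n \<Rightarrow> complex" where
  "del_delbar f z u v =
     (\<Sum>j\<in>UNIV. \<Sum>k\<in>UNIV. wirtinger j (wirtinger_bar k f) z *
        (u $ j * cnj (v $ k) - v $ j * cnj (u $ k)))"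

definition J_std :: "complex ^ 'n::finite \<Rightarrow> complex ^ 'n" where
  "J_std v = (\<chi> j. \<i> * v $ j)"

text \<open>The form below is real valued, so \<open>Re\<close> only changes the type
  (see \<open>kaehler_form_eq\<close>).\<close>

definition kaehler_form :: "complex ^ 'n::finite \<Rightarrow> complex ^ 'n \<Rightarrow> complex ^ 'n \<Rightarrow> real" where
  "kaehler_form z u v =
     Re (- (\<i> / 2) * del_delbar (\<lambda>w. complex_of_real (ln (1 - (norm w)\<^sup>2))) z u v)"

definition hyp_metric :: "complex ^ 'n::finite \<Rightarrow> complex ^ 'n \<Rightarrow> complex ^ 'n \<Rightarrow> real" where
  "hyp_metric z u v = kaehler_form z u (J_std v)"

text \<open>\<open>X\<close> is the Hamiltonian vector field of the time-dependent function \<open>f\<close>. Replacing \<open>f\<close> by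
  \<open>-f\<close> exchanges the two usual sign conventions, so that \<open>Ham\<^sub>c\<close> does not depend on the choice.\<close>

definition hamiltonian_vector_field ::
  "(real \<times> (complex ^ 'n::finite) \<Rightarrow> real) \<Rightarrow> (real \<Rightarrow> complex ^ 'n \<Rightarrow> complex ^ 'n) \<Rightarrow> bool" where
  "hamiltonian_vector_field f X \<longleftrightarrow>
     (\<forall>t\<in>{0..1}. \<forall>z\<in>ball 0 1. \<forall>v.
        kaehler_form z (X t z) v = frechet_derivative (\<lambda>w. f (t, w)) (at z) v)"

definition is_flow ::
  "(real \<Rightarrow> complex ^ 'n::finite \<Rightarrow> complex ^ 'n) \<Rightarrow> (real \<Rightarrow> complex ^ 'n \<Rightarrow> complex ^ 'n) \<Rightarrow> bool" where
  "is_flow X F \<longleftrightarrow>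
     (\<forall>z\<in>ball 0 1. F 0 z = z \<and>
        (\<forall>t\<in>{0..1}. F t z \<in> ball 0 1 \<and>
           ((\<lambda>s. F s z) has_vector_derivative X t (F t z)) (at t within {0..1})))"

text \<open>Only the values on \<open>ball 0 1\<close> of the elements of \<open>Ham_c\<close> are relevant.\<close>

definition Ham_c :: "(complex ^ 'n::finite \<Rightarrow> complex ^ 'n) set" where
  "Ham_c = {\<Psi>. \<exists>f X F K.
      smooth_on ({0..1} \<times> ball 0 1) f \<and>
      compact K \<and> K \<subseteq> {0..1} \<times> ball 0 1 \<and> (\<forall>p\<in>{0..1} \<times> ball 0 1 - K. f p = 0) \<and>
      hamiltonian_vector_field f X \<and> is_flow X F \<and> (\<forall>z\<in>ball 0 1. \<Psi> z = F 1 z)}"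

definition gram :: "(real ^ 'n::finite \<Rightarrow> complex ^ 'n) \<Rightarrow> real ^ 'n \<Rightarrow> real ^ 'n ^ 'n" where
  "gram \<phi> x = (\<chi> i j. hyp_metric (\<phi> x)
     (frechet_derivative \<phi> (at x) (axis i 1)) (frechet_derivative \<phi> (at x) (axis j 1)))"

text \<open>\<open>V\<close> is the Riemannian volume of \<open>S\<close>, computed from the induced volume density
  \<open>sqrt (det g\<^sub>i\<^sub>j)\<close> in an injective immersed parametrization \<open>\<phi>\<close> of \<open>S\<close> by a Borel set \<open>A\<close>. The
  set \<open>A\<close> need not be connected, so that a single \<open>\<phi>\<close> can consist of countably many local
  parametrizations restricted to disjoint Borel pieces. Hence every \<open>n\<close>-dimensional submanifold has
  a volume in this sense, and by the change of variables formula the volume depends on \<open>S\<close> only.\<close>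

definition has_volume :: "(complex ^ 'n::finite) set \<Rightarrow> ennreal \<Rightarrow> bool" where
  "has_volume S V \<longleftrightarrow>
     (\<exists>U A (\<phi> :: real ^ 'n \<Rightarrow> complex ^ 'n).
        open U \<and> A \<in> sets borel \<and> A \<subseteq> U \<and> C_k_on 1 U \<phi> \<and> \<phi> ` U \<subseteq> ball 0 1 \<and>
        (\<forall>x\<in>U. inj (frechet_derivative \<phi> (at x))) \<and> inj_on \<phi> A \<and> \<phi> ` A = S \<and>
        V = (\<integral>\<^sup>+x\<in>A. ennreal (sqrt (det (gram \<phi> x))) \<partial>lborel))"

text \<open>The notion is applied to Lagrangian submanifolds \<open>L\<close>. Being Lagrangian is not a part of the
  definition, so that the negation asserts the existence of a volume decreasing \<open>\<Psi>\<close>.\<close>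

definition hamiltonian_volume_minimizing :: "(complex ^ 'n::finite) set \<Rightarrow> bool" where
  "hamiltonian_volume_minimizing L \<longleftrightarrow>
     (\<forall>\<Psi>\<in>Ham_c. \<forall>V V'. has_volume L V \<and> has_volume (\<Psi> ` L) V' \<longrightarrow> V' \<ge> V)"

definition torus :: "('n::finite \<Rightarrow> real) \<Rightarrow> (complex ^ 'n) set" where
  "torus r = {w. \<exists>\<theta> :: 'n \<Rightarrow> real. w = (\<chi> i. complex_of_real (r i) * cis (\<theta> i))}"

definition hyp_to_flat :: "complex ^ 'n::finite \<Rightarrow> complex ^ 'n" where
  "hyp_to_flat z = (1 / sqrt (1 - (norm z)\<^sup>2)) *\<^sub>R z"

definition hyp_torus :: "('n::finite \<Rightarrow> real) \<Rightarrow> (complex ^ 'n) set" where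
  "hyp_torus r = {z \<in> ball 0 1. hyp_to_flat z \<in> torus r}"

lemma kaehler_potential_derivative:
  fixes w :: "complex ^ 'n::finite"
  assumes "w \<in> ball 0 1"
  shows "((\<lambda>w. complex_of_real (ln (1 - (norm w)\<^sup>2))) has_derivative
           (\<lambda>h. complex_of_real (- 2 * (w \<bullet> h) / (1 - (norm w)\<^sup>2)))) (at w)"
proof -
  have pos: "1 - w \<bullet> w > 0"
    using assms by (simp add: dot_square_norm abs_square_less_1)
  show ?thesis
    unfolding power2_norm_eq_inner
    by (rule derivative_eq_intros pos refl | simp add: pos)+
       (use pos in \<open>auto simp: fun_eq_iff field_simps inner_commute\<close>)
qed

lemma inner_axis_complex:
  "w \<bullet> axis k 1 = Re (w $ k)" "w \<bullet> axis k \<i> = Im (w $ k)" for w :: "complex ^ 'n::finite"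
  by (simp_all add: inner_axis)

lemma wirtinger_bar_kaehler_potential:
  fixes w :: "complex ^ 'n::finite"
  assumes "w \<in> ball 0 1"
  shows "wirtinger_bar k (\<lambda>w. complex_of_real (ln (1 - (norm w)\<^sup>2))) w =
           - (w $ k) / of_real (1 - (norm w)\<^sup>2)"
proof -
  have alg: "(complex_of_real (- 2 * Re c / t) + \<i> * complex_of_real (- 2 * Im c / t)) / 2 =
      - c / complex_of_real t" for c t
    by (simp add: complex_eq_iff)
  show ?thesis
    unfolding wirtinger_bar_def inner_axis_complex
      frechet_derivative_at[OF kaehler_potential_derivative[OF assms], symmetric]
    by (rule alg)
qed

lemma wirtinger_wirtinger_bar_kaehler_potential:
  fixes z :: "complex ^ 'n::finite"
  assumes z: "z \<in> ball 0 1"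
  defines "s \<equiv> complex_of_real (1 - (norm z)\<^sup>2)"
  shows "wirtinger j (wirtinger_bar k (\<lambda>w. complex_of_real (ln (1 - (norm w)\<^sup>2)))) z =
           - ((if j = k then 1 else 0) / s + cnj (z $ j) * z $ k / s\<^sup>2)"
proof -
  have pos: "1 - z \<bullet> z > 0"
    using z by (simp add: dot_square_norm abs_square_less_1)
  have s: "s = complex_of_real (1 - z \<bullet> z)" and s0: "s \<noteq> 0"
    using pos unfolding s_def power2_norm_eq_inner of_real_eq_0_iff by auto
  have "((\<lambda>w. - (w $ k) / complex_of_real (1 - w \<bullet> w)) has_derivative
          (\<lambda>h. - (h $ k) / s - of_real (2 * (z \<bullet> h)) * z $ k / s\<^sup>2)) (at z)"
  proof -
    have "((\<lambda>w. w $ k) has_derivative (\<lambda>h. h $ k)) (at z)"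
      by (rule bounded_linear_imp_has_derivative[OF bounded_linear_vec_nth])
    then have 1: "((\<lambda>w. - (w $ k)) has_derivative (\<lambda>h. - (h $ k))) (at z)"
      by (rule has_derivative_minus)
    have "((\<lambda>w. 1 - w \<bullet> w) has_derivative (\<lambda>h. - 2 * (z \<bullet> h))) (at z)"
      by (auto intro!: derivative_eq_intros simp: fun_eq_iff inner_commute)
    then have 2: "((\<lambda>w. complex_of_real (1 - w \<bullet> w)) has_derivative
        (\<lambda>h. complex_of_real (- 2 * (z \<bullet> h)))) (at z)"
      by (rule has_derivative_of_real)
    have nz: "complex_of_real (1 - z \<bullet> z) \<noteq> 0"
      using s0 s by simp
    show ?thesis
      by (rule has_derivative_eq_rhs[OF has_derivative_divide'[OF 1 2 nz]], unfold s[symmetric])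
         (use s0 in \<open>simp add: fun_eq_iff divide_simps power2_eq_square algebra_simps\<close>)
  qed
  then have D: "(wirtinger_bar k (\<lambda>w. complex_of_real (ln (1 - (norm w)\<^sup>2))) has_derivative
          (\<lambda>h. - (h $ k) / s - of_real (2 * (z \<bullet> h)) * z $ k / s\<^sup>2)) (at z)"
    by (rule has_derivative_transform_within_open[OF _ open_ball z])
       (simp only: wirtinger_bar_kaehler_potential, simp only: power2_norm_eq_inner)
  have c: "cnj (z $ j) = of_real (Re (z $ j)) - \<i> * of_real (Im (z $ j))"
    by (simp add: complex_eq_iff)
  have alg: "((- d / t - of_real (2 * x) * w / t\<^sup>2) - \<i> * (- (\<i> * d) / t - of_real (2 * y) * w / t\<^sup>2)) / 2 =
      - (d / t + (of_real x - \<i> * of_real y) * w / t\<^sup>2)" for d t w :: complex and x y :: real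
    by (simp add: ring_distribs diff_divide_distrib add_divide_distrib mult.assoc[symmetric])
  have ax: "axis j 1 $ k = (if j = k then 1 else 0 :: complex)"
    "axis j \<i> $ k = \<i> * (if j = k then 1 else 0 :: complex)"
    by (auto simp: axis_def)
  show ?thesis
    unfolding wirtinger_def frechet_derivative_at[OF D, symmetric] inner_axis_complex c ax
    by (rule alg)
qed

lemma kaehler_form_eq:
  fixes z u v :: "complex ^ 'n::finite"
  assumes z: "z \<in> ball 0 1"
  defines "s \<equiv> 1 - (norm z)\<^sup>2"
    and "H \<equiv> \<lambda>x y :: complex ^ 'n. \<Sum>j\<in>UNIV. x $ j * cnj (y $ j)"
  shows "complex_of_real (kaehler_form z u v) =
           - (\<i> / 2) * del_delbar (\<lambda>w. complex_of_real (ln (1 - (norm w)\<^sup>2))) z u v"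
    and "kaehler_form z u v = - Im (H u v / s + H u z * H z v / s\<^sup>2)"
proof -
  define Q where "Q = (\<lambda>x y. H x y / s + H x z * H z y / s\<^sup>2)"
  have pair: "(\<Sum>j\<in>UNIV. \<Sum>k\<in>UNIV.
      ((if j = k then 1 else 0) / complex_of_real s + cnj (z $ j) * z $ k / (complex_of_real s)\<^sup>2) *
        (x $ j * cnj (y $ k))) = Q x y" for x y :: "complex ^ 'n"
  proof -
    have 1: "(\<Sum>k\<in>UNIV. (if j = k then 1 else 0) / complex_of_real s * (x $ j * cnj (y $ k))) =
        x $ j * cnj (y $ j) / s" for j
      by (subst sum.remove[of _ j]) auto
    have 2: "(\<Sum>j\<in>UNIV. \<Sum>k\<in>UNIV. cnj (z $ j) * z $ k / (complex_of_real s)\<^sup>2 *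
        (x $ j * cnj (y $ k))) = H x z * H z y / s\<^sup>2"
      unfolding H_def sum_product sum_divide_distrib by (simp add: mult_ac)
    show ?thesis
      unfolding distrib_right sum.distrib 1 2 Q_def H_def sum_divide_distrib by simp
  qed
  have cnjQ: "Q v u = cnj (Q u v)"
    unfolding Q_def H_def by (simp add: mult_ac)
  have *: "del_delbar (\<lambda>w. complex_of_real (ln (1 - (norm w)\<^sup>2))) z u v = - (Q u v - Q v u)"
    unfolding del_delbar_def wirtinger_wirtinger_bar_kaehler_potential[OF z]
      s_def[symmetric] right_diff_distrib sum_subtractf mult_minus_left sum_negf pair
    by simp
  show "complex_of_real (kaehler_form z u v) =
           - (\<i> / 2) * del_delbar (\<lambda>w. complex_of_real (ln (1 - (norm w)\<^sup>2))) z u v"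
    unfolding kaehler_form_def * cnjQ by (simp add: complex_eq_iff)
  have "kaehler_form z u v = - Im (Q u v)"
    unfolding kaehler_form_def * cnjQ by simp
  then show "kaehler_form z u v = - Im (H u v / s + H u z * H z v / s\<^sup>2)"
    by (simp only: Q_def)
qed

end

theory Submission
  imports Defs
begin

text \<open>
  The map \<open>\<Phi>\<close> (\<open>hyp_to_flat\<close>, with inverse \<open>flat_to_hyp\<close>) turns the Kaehler form into the standard
  form of \<open>\<complex>\<^sup>n\<close>, so every compactly supported Hamiltonian flow of \<open>\<complex>\<^sup>n\<close> gives an element of \<open>Ham_c\<close>,
  whereas the metric becomes
  \<open>h \<bullet> k - (w \<bullet> h) (w \<bullet> k) / (1 + |w|\<^sup>2) + Im (herm h w) Im (herm k w)\<close>. With \<open>x\<^sub>l = r\<^sub>l\<^sup>2\<close> the torus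
  \<open>\<Phi>\<^sup>-\<^sup>1(T(r))\<close> has volume \<open>(2 \<pi>)\<^sup>n (\<Prod>x\<^sub>l (1 + \<Sum>x\<^sub>l))\<^sup>1\<^sup>/\<^sup>2\<close>. In both cases an explicit Hamiltonian isotopy moves
  the torus to a Lagrangian torus of smaller volume.

  If \<open>r\<^sub>i < r\<^sub>j < r\<^sub>k\<close>, the Hamiltonian \<open>(\<pi>/2) Im (cnj z\<^sub>i z\<^sub>j z\<^sub>k / |z\<^sub>k|)\<close> generates the rotation
  of the pair \<open>(z\<^sub>i, z\<^sub>j z\<^sub>k / |z\<^sub>k|)\<close> by a quarter turn, which keeps \<open>|z\<^sub>k|\<^sup>2 - |z\<^sub>j|\<^sup>2\<close> and the argument
  of \<open>z\<^sub>k\<close>. As \<open>r\<^sub>k > r\<^sub>j\<close>, the coordinate \<open>z\<^sub>k\<close> never vanishes along the way. At time one \<open>x\<^sub>i\<close> and \<open>x\<^sub>j\<close> are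
  exchanged and \<open>x\<^sub>k\<close> has become \<open>x\<^sub>k - (x\<^sub>j - x\<^sub>i)\<close>: the result is a product torus and both factors of
  the volume have decreased (\<open>not_minimizing_of_three_radii\<close>).

  If \<open>(1 + \<Sum>x\<^sub>l) x\<^sub>i < x\<^sub>j x\<^sub>k\<close>, consider the resonance \<open>\<psi> = \<theta>\<^sub>i - \<theta>\<^sub>j - \<theta>\<^sub>k\<close>, with coefficients
  \<open>m = (1, -1, -1)\<close>. The Hamiltonian \<open>e sin \<psi>\<close> moves the torus to the graph
  \<open>|z\<^sub>l|\<^sup>2 = x\<^sub>l + 2 m\<^sub>l e cos \<psi>\<close>. The Gram determinant of the graph is that of a diagonal matrix plus
  a matrix of rank two (\<open>det_diagonal_plus_rank_two\<close>), and with \<open>A, B, C, E\<close> the reciprocals of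
  \<open>x\<^sub>i, x\<^sub>j, x\<^sub>k, 1 + \<Sum>x\<^sub>l\<close> the second order term of the volume in \<open>e\<close> has the sign of \<open>BC - AE\<close>,
  which is negative (\<open>second_variation_bound\<close>, \<open>not_minimizing_of_unstable\<close>). The
  integral over \<open>\<psi>\<close> is replaced by the average over the four rotations of \<open>\<psi>\<close> by multiples of
  \<open>\<pi>/2\<close>, for which the estimate holds pointwise.

  Both Hamiltonians are only defined on open sets and have to be cut off
  (\<open>hamiltonian_extension\<close>). The flow is known explicitly on the torus, where alone it matters; the existence of a
  flow elsewhere follows from the Picard-Lindeloef theorem.
\<close>

section \<open>Calculus of \<open>C\<^sup>k\<close> functions\<close>

lemma C_k_on_has_derivative:
  assumes "C_k_on (Suc k) U f" "open U" "x \<in> U"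
  shows "(f has_derivative frechet_derivative f (at x)) (at x)"
proof -
  have "f differentiable_on U" using assms(1) by simp
  then have "f differentiable (at x)"
    using differentiable_on_eq_differentiable_at[OF assms(2)] assms(3) by blast
  then show ?thesis by (simp add: frechet_derivative_works[symmetric])
qed

lemma C_k_on_cong:
  assumes "open U" "\<And>x. x \<in> U \<Longrightarrow> f x = g x" "C_k_on k U f"
  shows "C_k_on k U g"
  using assms(2,3)
proof (induction k arbitrary: f g)
  case 0
  then show ?case by (simp cong: continuous_on_cong)
next
  case (Suc k)
  have d: "(g has_derivative frechet_derivative f (at x)) (at x)" if "x \<in> U" for x
    using C_k_on_has_derivative[OF Suc.prems(2) assms(1) that] Suc.prems(1) that assms(1)
    by (meson has_derivative_transform_within_open)
  then have "frechet_derivative f (at x) = frechet_derivative g (at x)" if "x \<in> U" for x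
    using frechet_derivative_at that by blast
  then have "C_k_on k U (\<lambda>x. frechet_derivative g (at x) v)" for v
    using Suc.IH[of "\<lambda>x. frechet_derivative f (at x) v"] Suc.prems(2) by simp
  moreover have "g differentiable_on U"
    using d by (meson differentiable_at_imp_differentiable_on differentiable_def)
  ultimately show ?case by simp
qed

lemma C_k_on_Suc_intro:
  assumes "open U" "\<And>x. x \<in> U \<Longrightarrow> (f has_derivative f' x) (at x)"
    and "\<And>v. C_k_on k U (\<lambda>x. f' x v)"
  shows "C_k_on (Suc k) U f"
proof -
  have eq: "frechet_derivative f (at x) = f' x" if "x \<in> U" for x
    using frechet_derivative_at[OF assms(2)[OF that]] by simp
  have "f differentiable_on U"
    using assms(2) by (meson differentiable_at_imp_differentiable_on differentiable_def)
  moreover have "C_k_on k U (\<lambda>x. frechet_derivative f (at x) v)" for v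
    by (rule C_k_on_cong[OF assms(1) _ assms(3)[of v]]) (simp add: eq)
  ultimately show ?thesis by simp
qed

lemma C_k_on_Suc_imp: "C_k_on (Suc k) U f \<Longrightarrow> C_k_on k U f"
  by (induction k arbitrary: f) (auto simp: differentiable_imp_continuous_on)

lemma C_k_on_subset: "C_k_on k U f \<Longrightarrow> V \<subseteq> U \<Longrightarrow> C_k_on k V f"
  by (induction k arbitrary: f) (auto intro: continuous_on_subset differentiable_on_subset)

lemma C_k_on_Un:
  assumes "open U" "open V" "C_k_on k U f" "C_k_on k V f"
  shows "C_k_on k (U \<union> V) f"
  using assms(3,4)
proof (induction k arbitrary: f)
  case 0
  then show ?case using assms by (auto intro: continuous_on_open_Un)
next
  case (Suc k)
  then show ?case
    using assms(1,2) by (auto simp: differentiable_on_eq_differentiable_at open_Un)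
qed

lemma C_k_on_const: "C_k_on k U (\<lambda>x. c)"
  by (induction k arbitrary: c) simp_all

lemma C_k_on_add:
  assumes "open U"
  shows "C_k_on k U f \<Longrightarrow> C_k_on k U g \<Longrightarrow> C_k_on k U (\<lambda>x. f x + g x)"
proof (induction k arbitrary: f g)
  case 0
  then show ?case by (simp add: continuous_on_add)
next
  case (Suc k)
  note d = C_k_on_has_derivative[OF Suc.prems(1) assms] C_k_on_has_derivative[OF Suc.prems(2) assms]
  show ?case
    by (rule C_k_on_Suc_intro[OF assms has_derivative_add[OF d]])
       (use Suc assms in auto)
qed

lemma C_k_on_linear:
  assumes "open U" "bounded_linear h"
  shows "C_k_on k U f \<Longrightarrow> C_k_on k U (\<lambda>x. h (f x))"
proof (induction k arbitrary: f)
  case 0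
  then show ?case by (simp add: bounded_linear.continuous_on[OF assms(2)])
next
  case (Suc k)
  note d = C_k_on_has_derivative[OF Suc.prems(1) assms(1)]
  show ?case
    by (rule C_k_on_Suc_intro[OF assms(1) bounded_linear.has_derivative[OF assms(2) d]])
       (use Suc assms in auto)
qed

lemma C_k_on_bilinear:
  assumes "open U" "bounded_bilinear h"
  shows "C_k_on k U f \<Longrightarrow> C_k_on k U g \<Longrightarrow> C_k_on k U (\<lambda>x. h (f x) (g x))"
proof (induction k arbitrary: f g)
  case 0
  then show ?case by (simp add: bounded_bilinear.continuous_on[OF assms(2)])
next
  case (Suc k)
  note d = C_k_on_has_derivative[OF Suc.prems(1) assms(1)] C_k_on_has_derivative[OF Suc.prems(2) assms(1)]
  show ?case
    by (rule C_k_on_Suc_intro[OF assms(1) bounded_bilinear.FDERIV[OF assms(2) d]])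
       (use Suc.prems C_k_on_Suc_imp[OF Suc.prems(1)] C_k_on_Suc_imp[OF Suc.prems(2)] in
        \<open>auto intro!: C_k_on_add assms Suc.IH\<close>)
qed

lemma C_k_on_id: "open U \<Longrightarrow> C_k_on k U (\<lambda>x. x)"
  by (cases k) (simp, simp only:, rule C_k_on_Suc_intro[where f'="\<lambda>x v. v"], auto intro: C_k_on_const)

lemma C_k_on_sum:
  assumes "open U" "\<And>i. i \<in> I \<Longrightarrow> C_k_on k U (f i)"
  shows "C_k_on k U (\<lambda>x. \<Sum>i\<in>I. f i x)"
proof (cases "finite I")
  case True
  then show ?thesis using assms(2)
    by (induction I) (auto intro: C_k_on_const C_k_on_add[OF assms(1)])
qed (simp add: C_k_on_const)

text \<open>The chain rule contains the derivative of the outer function in the direction of a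
  varying vector. Expanding that vector in the basis leaves directional derivatives in fixed
  directions, to which the induction hypothesis applies.\<close>
lemma C_k_on_compose:
  fixes g :: "'a::euclidean_space \<Rightarrow> 'b::euclidean_space"
  assumes "open U" "open V" "g ` U \<subseteq> V"
  shows "C_k_on k V f \<Longrightarrow> C_k_on k U g \<Longrightarrow> C_k_on k U (\<lambda>x. f (g x))"
proof (induction k arbitrary: f)
  case 0
  then have f: "continuous_on V f" and g: "continuous_on U g" by simp_all
  show ?case unfolding C_k_on.simps by (rule continuous_on_compose2[OF f g assms(3)])
next
  case (Suc k)
  let ?D = "\<lambda>x. frechet_derivative g (at x)"
  have d: "((\<lambda>x. f (g x)) has_derivative (\<lambda>v. \<Sum>b\<in>Basis. (?D x v \<bullet> b) *\<^sub>R frechet_derivative f (at (g x)) b)) (at x)"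
    if "x \<in> U" for x
  proof -
    have dg: "(g has_derivative ?D x) (at x)"
      by (rule C_k_on_has_derivative[OF Suc.prems(2) assms(1) that])
    have df: "(f has_derivative frechet_derivative f (at (g x))) (at (g x))"
      using C_k_on_has_derivative[OF Suc.prems(1) assms(2)] that assms(3) by blast
    interpret bounded_linear "frechet_derivative f (at (g x))"
      using df by (rule has_derivative_bounded_linear)
    have "frechet_derivative f (at (g x)) (\<Sum>b\<in>Basis. (y \<bullet> b) *\<^sub>R b) =
        (\<Sum>b\<in>Basis. (y \<bullet> b) *\<^sub>R frechet_derivative f (at (g x)) b)" for y
      unfolding sum scaleR ..
    then have "(frechet_derivative f (at (g x)) \<circ> ?D x) v =
        (\<Sum>b\<in>Basis. (?D x v \<bullet> b) *\<^sub>R frechet_derivative f (at (g x)) b)" for v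
      unfolding euclidean_representation o_apply .
    then have "frechet_derivative f (at (g x)) \<circ> ?D x =
        (\<lambda>v. \<Sum>b\<in>Basis. (?D x v \<bullet> b) *\<^sub>R frechet_derivative f (at (g x)) b)"
      by (rule ext)
    then show ?thesis
      using diff_chain_at[OF dg df] by (simp only: o_def)
  qed
  show ?case
  proof (rule C_k_on_Suc_intro[OF assms(1) d])
    fix v
    have "C_k_on k U (\<lambda>x. ?D x v \<bullet> b)" for b
      using Suc.prems(2) by (intro C_k_on_linear[OF assms(1) bounded_linear_inner_left]) simp
    moreover have "C_k_on k U (\<lambda>x. frechet_derivative f (at (g x)) b)" for b
      by (rule Suc.IH[OF _ C_k_on_Suc_imp[OF Suc.prems(2)]]) (use Suc.prems(1) in simp)
    ultimately show "C_k_on k U (\<lambda>x. \<Sum>b\<in>Basis. (?D x v \<bullet> b) *\<^sub>R frechet_derivative f (at (g x)) b)"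
      by (intro C_k_on_sum C_k_on_bilinear[OF _ bounded_bilinear_scaleR] assms(1))
  qed
qed

lemma C_k_on_real_Suc:
  fixes f :: "real \<Rightarrow> real"
  assumes "open U" "\<And>x. x \<in> U \<Longrightarrow> (f has_field_derivative f' x) (at x)" "C_k_on k U f'"
  shows "C_k_on (Suc k) U f"
  by (rule C_k_on_Suc_intro[OF assms(1) has_field_derivative_imp_has_derivative[OF assms(2)]])
     (use assms(1,3) in \<open>auto intro!: C_k_on_bilinear[OF _ bounded_bilinear_mult] C_k_on_const\<close>)

text \<open>Powers with arbitrary real exponents are closed under differentiation up to constant
  factors; square roots and reciprocals are special cases.\<close>
lemma C_k_on_powr_const: "C_k_on k {0<..} (\<lambda>x::real. x powr a)"
proof (induction k arbitrary: a)
  case 0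
  show ?case by (auto intro!: continuous_intros)
next
  case (Suc k)
  show ?case
    by (rule C_k_on_real_Suc[OF _ has_real_derivative_powr])
       (auto intro!: C_k_on_bilinear[OF _ bounded_bilinear_mult] C_k_on_const Suc)
qed

lemma C_k_on_powr:
  fixes f :: "'a::euclidean_space \<Rightarrow> real"
  assumes "open U" "\<And>x. x \<in> U \<Longrightarrow> f x > 0" "C_k_on k U f"
  shows "C_k_on k U (\<lambda>x. f x powr a)"
  by (rule C_k_on_compose[OF assms(1) open_greaterThan[of 0] _ C_k_on_powr_const assms(3)]) (use assms(2) in auto)

lemma C_k_on_sin_cos: "C_k_on k UNIV (sin :: real \<Rightarrow> real) \<and> C_k_on k UNIV (cos :: real \<Rightarrow> real)"
proof (induction k)
  case 0
  show ?case by (auto intro!: continuous_intros)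
next
  case (Suc k)
  have "C_k_on (Suc k) UNIV (sin :: real \<Rightarrow> real)"
    by (rule C_k_on_real_Suc[OF _ DERIV_sin]) (use Suc in auto)
  moreover have "C_k_on k UNIV (\<lambda>x::real. - sin x)"
    using Suc C_k_on_linear[OF open_UNIV bounded_linear_minus[OF bounded_linear_ident]] by blast
  then have "C_k_on (Suc k) UNIV (cos :: real \<Rightarrow> real)"
    by (intro C_k_on_real_Suc[OF _ DERIV_cos]) auto
  ultimately show ?case by blast
qed

lemmas C_k_on_sin = C_k_on_compose[OF _ open_UNIV subset_UNIV C_k_on_sin_cos[THEN conjunct1]]
lemmas C_k_on_cos = C_k_on_compose[OF _ open_UNIV subset_UNIV C_k_on_sin_cos[THEN conjunct2]]
lemmas C_k_on_mult = C_k_on_bilinear[OF _ bounded_bilinear_mult]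
lemmas C_k_on_scaleR = C_k_on_bilinear[OF _ bounded_bilinear_scaleR]
lemmas C_k_on_inner = C_k_on_bilinear[OF _ bounded_bilinear_inner]

lemma C_k_on_diff:
  assumes "open U" "C_k_on k U f" "C_k_on k U g"
  shows "C_k_on k U (\<lambda>x. f x - g x)"
  using C_k_on_add[OF assms(1,2) C_k_on_linear[OF assms(1) bounded_linear_minus[OF bounded_linear_ident] assms(3)]]
  by simp

lemma C_k_on_vec_lambda:
  fixes f :: "'n::finite \<Rightarrow> 'a::euclidean_space \<Rightarrow> 'b::euclidean_space"
  assumes "open U" "\<And>i. C_k_on k U (f i)"
  shows "C_k_on k U (\<lambda>x. \<chi> i. f i x)"
proof -
  have "bounded_linear (axis i :: 'b \<Rightarrow> 'b ^ 'n)" for i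
    by (rule linear_conv_bounded_linear[THEN iffD1])
       (auto intro!: linearI simp: axis_def vec_eq_iff)
  then have "C_k_on k U (\<lambda>x. \<Sum>i\<in>UNIV. axis i (f i x))"
    by (intro C_k_on_sum[OF assms(1)] C_k_on_linear[OF assms(1) _ assms(2)])
  moreover have "(\<Sum>i\<in>UNIV. axis i (f i x)) = (\<chi> i. f i x)" for x
    by (auto simp: vec_eq_iff axis_def if_distrib sum.delta cong: if_cong)
  ultimately show ?thesis by simp
qed

lemmas C_k_on_nth = C_k_on_linear[OF _ bounded_linear_vec_nth]

section \<open>Smooth cutoff functions\<close>

text \<open>The factors \<open>x ^ j\<close> in the denominator make the family closed under
  differentiation, so that all members are smooth by one induction.\<close>
definition exp_flat :: "nat \<Rightarrow> real \<Rightarrow> real" where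
  "exp_flat j x = (if x \<le> 0 then 0 else exp (- 1 / x) / x ^ j)"

lemma exp_flat_tendsto_0: "(exp_flat j \<longlongrightarrow> 0) (at 0)"
proof -
  have "((\<lambda>x. inverse x ^ j / exp (inverse x)) \<longlongrightarrow> (0::real)) (at_right 0)"
    by (rule filterlim_compose[OF tendsto_power_div_exp_0 filterlim_inverse_at_top_right])
  moreover have "\<forall>\<^sub>F x in at_right 0. inverse x ^ j / exp (inverse x) = exp_flat j x"
    unfolding eventually_at_right_field
    by (intro exI[of _ 1]) (auto simp: exp_flat_def exp_minus field_simps power_inverse)
  ultimately have "(exp_flat j \<longlongrightarrow> 0) (at_right 0)"
    by (rule Lim_transform_eventually)
  moreover have "(exp_flat j \<longlongrightarrow> 0) (at_left 0)"
    by (rule Lim_transform_eventually[OF tendsto_const])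
       (auto simp: exp_flat_def eventually_at_left_field intro!: exI[of _ "-1"])
  ultimately show ?thesis by (simp add: filterlim_split_at)
qed

lemma exp_flat_has_derivative:
  "(exp_flat j has_real_derivative exp_flat (j + 2) x - j * exp_flat (j + 1) x) (at x)"
proof -
  consider "x < 0" | "x > 0" | "x = 0" by linarith
  then show ?thesis
  proof cases
    case 1
    have "(exp_flat j has_real_derivative 0) (at x)"
      by (rule has_field_derivative_transform_within[where f="\<lambda>_. 0" and d="-x"]) (use 1 in \<open>auto simp: exp_flat_def dist_real_def\<close>)
    then show ?thesis using 1 by (simp add: exp_flat_def)
  next
    case 2
    have "((\<lambda>x. exp (- 1 / x) / x ^ j) has_real_derivative exp_flat (j + 2) x - j * exp_flat (j + 1) x) (at x)"
      using 2 power_minus_mult[of j x]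
      by (cases "j = 0") (auto intro!: derivative_eq_intros simp: exp_flat_def field_simps power2_eq_square power_add)
    then show ?thesis
      by (rule has_field_derivative_transform_within[where d=x]) (use 2 in \<open>auto simp: exp_flat_def dist_real_def\<close>)
  next
    case 3
    have "((\<lambda>h. (exp_flat j (0 + h) - exp_flat j 0) / h) \<longlongrightarrow> 0) (at 0)"
      using exp_flat_tendsto_0[of "j + 1"]
      by (rule Lim_transform_eventually) (auto simp: exp_flat_def eventually_at_filter divide_simps)
    then show ?thesis
      unfolding 3 DERIV_def by (simp add: exp_flat_def)
  qed
qed

lemma C_k_on_exp_flat: "C_k_on k UNIV (exp_flat j)"
proof (induction k arbitrary: j)
  case 0
  show ?case
    using exp_flat_has_derivative by (auto intro!: DERIV_continuous_on)
next
  case (Suc k)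
  show ?case
    by (rule C_k_on_real_Suc[OF _ exp_flat_has_derivative])
       (auto intro!: C_k_on_diff C_k_on_mult C_k_on_const Suc)
qed

definition smooth_step :: "real \<Rightarrow> real" where
  "smooth_step x = exp_flat 0 x * (exp_flat 0 x + exp_flat 0 (1 - x)) powr (-1)"

lemma smooth_step_0: "x \<le> 0 \<Longrightarrow> smooth_step x = 0"
  by (simp add: smooth_step_def exp_flat_def)

lemma smooth_step_1: "x \<ge> 1 \<Longrightarrow> smooth_step x = 1"
  by (simp add: smooth_step_def exp_flat_def powr_minus)

lemma smooth_step_nonneg: "smooth_step x \<ge> 0"
  by (simp add: smooth_step_def exp_flat_def)

lemma C_k_on_smooth_step:
  assumes "open U" "C_k_on k U f"
  shows "C_k_on k U (\<lambda>x. smooth_step (f x))"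
proof -
  have 1: "C_k_on k U (\<lambda>x. exp_flat 0 (f x))"
    by (rule C_k_on_compose[OF assms(1) open_UNIV _ C_k_on_exp_flat assms(2)]) simp
  have "C_k_on k U (\<lambda>x. 1 - f x)"
    by (intro C_k_on_diff C_k_on_const assms)
  then have 2: "C_k_on k U (\<lambda>x. exp_flat 0 (1 - f x))"
    by (intro C_k_on_compose[OF assms(1) open_UNIV _ C_k_on_exp_flat]) simp_all
  have pos: "exp_flat 0 (f x) + exp_flat 0 (1 - f x) > 0" for x
    by (auto simp: exp_flat_def intro: add_pos_pos)
  show ?thesis
    unfolding smooth_step_def
    by (intro C_k_on_mult C_k_on_powr C_k_on_add assms(1) 1 2 pos)
qed

text \<open>Compactness covers \<open>K\<close> by finitely many balls on which a radial bump
  function equals \<open>1\<close>. Their sum is at least \<open>1\<close> near \<open>K\<close>,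
  and \<open>smooth_step\<close> truncates it to \<open>1\<close>.\<close>
lemma smooth_cutoff:
  fixes K W :: "'a::euclidean_space set"
  assumes "compact K" "open W" "K \<subseteq> W"
  obtains \<phi> :: "'a \<Rightarrow> real" and K' V where
    "\<And>k. C_k_on k UNIV \<phi>" "compact K'" "K' \<subseteq> W" "\<And>x. x \<notin> K' \<Longrightarrow> \<phi> x = 0"
    "open V" "K \<subseteq> V" "V \<subseteq> W" "\<And>x. x \<in> V \<Longrightarrow> \<phi> x = 1"
proof -
  have "\<exists>\<rho>. \<rho> > 0 \<and> cball x (2 * \<rho>) \<subseteq> W" if "x \<in> K" for x
  proof -
    obtain e where "e > 0" "cball x e \<subseteq> W"
      using assms \<open>x \<in> K\<close> by (meson open_contains_cball subsetD)
    then show ?thesis by (intro exI[of _ "e / 2"]) simp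
  qed
  then obtain \<rho> where \<rho>: "\<And>x. x \<in> K \<Longrightarrow> \<rho> x > 0" "\<And>x. x \<in> K \<Longrightarrow> cball x (2 * \<rho> x) \<subseteq> W"
    by metis
  have "K \<subseteq> (\<Union>x\<in>K. ball x (\<rho> x))"
    using \<rho>(1) by fastforce
  then obtain C where C: "C \<subseteq> K" "finite C" "K \<subseteq> (\<Union>x\<in>C. ball x (\<rho> x))"
    using compactE_image[OF assms(1), of K "\<lambda>x. ball x (\<rho> x)"] by auto
  define b where "b = (\<lambda>x y. smooth_step (2 - ((y - x) \<bullet> (y - x)) / (\<rho> x)\<^sup>2))"
  have b1: "b x y = 1" if "x \<in> C" "y \<in> ball x (\<rho> x)" for x y
  proof -
    have "(y - x) \<bullet> (y - x) \<le> (\<rho> x)\<^sup>2"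
      using that(2) by (simp add: dot_square_norm dist_norm norm_minus_commute power_mono)
    then have "((y - x) \<bullet> (y - x)) / (\<rho> x)\<^sup>2 \<le> 1"
      using \<rho>(1) C(1) that(1) by (simp add: divide_le_eq_1)
    then show ?thesis
      unfolding b_def by (intro smooth_step_1) simp
  qed
  have b0: "b x y = 0" if "x \<in> C" "y \<notin> cball x (2 * \<rho> x)" for x y
  proof -
    have p: "\<rho> x > 0" using \<rho>(1) C(1) that(1) by blast
    have "(y - x) \<bullet> (y - x) \<ge> (2 * \<rho> x)\<^sup>2"
      using that(2) p unfolding dot_square_norm by (intro power_mono) (auto simp: dist_norm norm_minus_commute)
    moreover have "2 * (\<rho> x)\<^sup>2 \<le> (2 * \<rho> x)\<^sup>2"
      by (simp add: power_mult_distrib)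
    ultimately have "(y - x) \<bullet> (y - x) \<ge> 2 * (\<rho> x)\<^sup>2"
      by (rule order_trans[rotated])
    then have "((y - x) \<bullet> (y - x)) / (\<rho> x)\<^sup>2 \<ge> 2"
      using p by (simp add: le_divide_eq)
    then show ?thesis
      unfolding b_def by (intro smooth_step_0) simp
  qed
  define \<phi> where "\<phi> = (\<lambda>y. smooth_step (\<Sum>x\<in>C. b x y))"
  show thesis
  proof
    have "C_k_on k UNIV (b x)" for k x
      unfolding b_def divide_inverse
      by (intro C_k_on_smooth_step C_k_on_diff C_k_on_const C_k_on_mult C_k_on_inner C_k_on_id open_UNIV)
    then show "C_k_on k UNIV \<phi>" for k
      unfolding \<phi>_def by (intro C_k_on_smooth_step C_k_on_sum open_UNIV)
    show "compact (\<Union>x\<in>C. cball x (2 * \<rho> x))"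
      using C(2) by (intro compact_UN) auto
    show "(\<Union>x\<in>C. cball x (2 * \<rho> x)) \<subseteq> W"
      using \<rho>(2) C(1) by blast
    show "\<phi> y = 0" if "y \<notin> (\<Union>x\<in>C. cball x (2 * \<rho> x))" for y
    proof -
      have "(\<Sum>x\<in>C. b x y) = 0"
        using that b0 by (intro sum.neutral) blast
      then show ?thesis by (simp add: \<phi>_def smooth_step_0)
    qed
    show "open (\<Union>x\<in>C. ball x (\<rho> x))" by blast
    show "K \<subseteq> (\<Union>x\<in>C. ball x (\<rho> x))" by (rule C(3))
    show "(\<Union>x\<in>C. ball x (\<rho> x)) \<subseteq> W"
    proof
      fix y assume "y \<in> (\<Union>x\<in>C. ball x (\<rho> x))"
      then obtain x where x: "x \<in> C" "dist x y < \<rho> x" by auto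
      then have "y \<in> cball x (2 * \<rho> x)" using \<rho>(1)[of x] C(1) by auto
      then show "y \<in> W" using \<rho>(2) x(1) C(1) by blast
    qed
    show "\<phi> y = 1" if "y \<in> (\<Union>x\<in>C. ball x (\<rho> x))" for y
    proof -
      from that obtain x where x: "x \<in> C" "y \<in> ball x (\<rho> x)" by blast
      have "b x y \<le> (\<Sum>x\<in>C. b x y)"
        by (rule member_le_sum[OF x(1)]) (auto simp: b_def smooth_step_nonneg C(2))
      then show ?thesis
        unfolding \<phi>_def using b1[OF x] by (intro smooth_step_1) simp
    qed
  qed
qed

section \<open>Flows of Lipschitz vector fields\<close>

text \<open>Picard iteration: the difference of consecutive iterates is bounded by \<open>M L ^ n t
  ^ (n + 1) / (n + 1)!\<close>, so that the iterates converge uniformly on the whole interval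
  \<open>[0, 1]\<close> whatever the size of \<open>L\<close>.\<close>
lemma lipschitz_ode_solution:
  fixes Y :: "'a::euclidean_space \<Rightarrow> 'a"
  assumes lip: "\<And>x y. norm (Y x - Y y) \<le> L * norm (x - y)"
  obtains y :: "real \<Rightarrow> 'a" where "y 0 = w"
    "\<And>t. t \<in> {0..1} \<Longrightarrow> (y has_vector_derivative Y (y t)) (at t within {0..1})"
proof -
  have L: "L \<ge> 0"
  proof -
    obtain b :: 'a where "b \<in> Basis" using nonempty_Basis by blast
    then have "0 \<le> L * norm (b - 0)" using lip[of b 0] norm_ge_zero order_trans by blast
    then show ?thesis using \<open>b \<in> Basis\<close> by simp
  qed
  have contY: "continuous_on S Y" for S
  proof (rule continuous_on_subset[OF _ subset_UNIV], unfold continuous_on_iff, intro ballI allI impI)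
    fix x :: 'a and e :: real assume "e > 0"
    then have "\<And>x'. dist x' x < e / (L + 1) \<Longrightarrow> dist (Y x') (Y x) < e"
    proof -
      fix x' assume "dist x' x < e / (L + 1)"
      then have "(L + 1) * norm (x' - x) < e"
        using L by (simp add: dist_norm pos_less_divide_eq mult.commute)
      moreover have "L * norm (x' - x) \<le> (L + 1) * norm (x' - x)"
        by (simp add: mult_right_mono)
      ultimately show "dist (Y x') (Y x) < e"
        using lip[of x' x] by (simp add: dist_norm)
    qed
    moreover have "e / (L + 1) > 0" using L \<open>e > 0\<close> by simp
    ultimately show "\<exists>d>0. \<forall>x'\<in>UNIV. dist x' x < d \<longrightarrow> dist (Y x') (Y x) < e" by blast
  qed
  define P where "P = (\<lambda>y (t::real). w + integral {0..t} (\<lambda>s. Y (y s)))"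
  define y where "y = (\<lambda>n. (P ^^ n) (\<lambda>_. w))"
  have y0: "y 0 = (\<lambda>_. w)" and ySuc: "y (Suc n) = P (y n)" for n
    by (simp_all add: y_def)
  have cont: "continuous_on {0..1} (y n)" for n
  proof (induction n)
    case (Suc n)
    have "continuous_on {0..1} (\<lambda>s. Y (y n s))"
      by (rule continuous_on_compose2[OF contY[of UNIV] Suc]) simp
    then show ?case
      unfolding ySuc P_def
      by (intro continuous_intros indefinite_integral_continuous_1 integrable_continuous_real)
  qed (simp add: y0)
  have contY': "continuous_on {0..t} (\<lambda>s. Y (y n s))" if "t \<in> {0..1}" for t n
    by (rule continuous_on_compose2[OF contY[of UNIV] continuous_on_subset[OF cont]]) (use that in auto)
  define M where "M = norm (Y w)"
  have bound: "norm (y (Suc n) t - y n t) \<le> M * L ^ n * t ^ Suc n / fact (Suc n)" if "t \<in> {0..1}" for n t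
    using that
  proof (induction n arbitrary: t)
    case 0
    then show ?case by (simp add: y0 y_def P_def M_def mult.commute)
  next
    case (Suc n)
    have "y (Suc (Suc n)) t - y (Suc n) t = integral {0..t} (\<lambda>s. Y (y (Suc n) s) - Y (y n s))"
      using integral_diff[OF integrable_continuous_real integrable_continuous_real,
          OF contY'[OF Suc.prems, of "Suc n"] contY'[OF Suc.prems, of n]]
        fun_cong[OF ySuc[of "Suc n"], of t] fun_cong[OF ySuc[of n], of t]
      by (simp add: P_def)
    also have "norm \<dots> \<le> integral {0..t} (\<lambda>s. L * (M * L ^ n * s ^ Suc n / fact (Suc n)))"
    proof (rule integral_norm_bound_integral)
      show "(\<lambda>s. Y (y (Suc n) s) - Y (y n s)) integrable_on {0..t}"
        by (intro integrable_diff integrable_continuous_real contY' Suc.prems)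
      show "(\<lambda>s. L * (M * L ^ n * s ^ Suc n / fact (Suc n))) integrable_on {0..t}"
        by (intro integrable_continuous_real continuous_intros) simp
      fix s assume "s \<in> {0..t}"
      then have "norm (y (Suc n) s - y n s) \<le> M * L ^ n * s ^ Suc n / fact (Suc n)"
        using Suc.prems by (intro Suc.IH) auto
      then show "norm (Y (y (Suc n) s) - Y (y n s)) \<le> L * (M * L ^ n * s ^ Suc n / fact (Suc n))"
        using lip[of "y (Suc n) s" "y n s"] mult_left_mono[OF _ L] by (meson order_trans)
    qed
    also have "\<dots> = M * L ^ Suc n * t ^ Suc (Suc n) / fact (Suc (Suc n))"
    proof (rule integral_unique)
      have "((\<lambda>s. L * (M * L ^ n * s ^ Suc n / fact (Suc n))) has_integral
          (M * L ^ Suc n * t ^ Suc (Suc n) / fact (Suc (Suc n)) -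
           M * L ^ Suc n * 0 ^ Suc (Suc n) / fact (Suc (Suc n)))) {0..t}"
      proof (rule fundamental_theorem_of_calculus)
        show "0 \<le> t" using Suc.prems by simp
        fix s
        have "((\<lambda>s. M * L ^ Suc n * s ^ Suc (Suc n) / fact (Suc (Suc n))) has_real_derivative
            M * L ^ Suc n * (real (Suc (Suc n)) * s ^ Suc n) / fact (Suc (Suc n))) (at s within {0..t})"
          by (rule derivative_eq_intros refl | simp)+
        also have "M * L ^ Suc n * (real (Suc (Suc n)) * s ^ Suc n) / fact (Suc (Suc n)) =
            L * (M * L ^ n * s ^ Suc n / fact (Suc n))"
          by (simp only: fact_Suc[of "Suc n"] of_nat_mult power_Suc[of L] times_divide_eq_right)
             (simp add: divide_simps)
        finally show "((\<lambda>s. M * L ^ Suc n * s ^ Suc (Suc n) / fact (Suc (Suc n))) has_vector_derivative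
            L * (M * L ^ n * s ^ Suc n / fact (Suc n))) (at s within {0..t})"
          by (simp only: has_real_derivative_iff_has_vector_derivative)
      qed
      then show "((\<lambda>s. L * (M * L ^ n * s ^ Suc n / fact (Suc n))) has_integral
          M * L ^ Suc n * t ^ Suc (Suc n) / fact (Suc (Suc n))) {0..t}" by simp
    qed
    finally show ?case .
  qed
  have bound': "norm (y (Suc n) t - y n t) \<le> M * (L ^ n / fact n)" if "t \<in> {0..1}" for n t
  proof -
    have "t ^ Suc n \<le> 1" using that by (intro power_le_one) auto
    then have "(M * L ^ n) * t ^ Suc n \<le> (M * L ^ n) * 1"
      using L by (intro mult_left_mono) (auto simp: M_def)
    moreover have "fact n \<le> (fact (Suc n) :: real)" by (rule fact_mono) simp
    ultimately have "M * L ^ n * t ^ Suc n / fact (Suc n) \<le> M * L ^ n / fact n"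
      using L by (intro frac_le) (auto simp: M_def)
    then show ?thesis using bound[OF that, of n] by simp
  qed
  have "summable (\<lambda>n. M * (L ^ n / fact n))"
    using summable_exp[of L] by (intro summable_mult) (simp add: divide_inverse mult.commute)
  moreover have tel: "(\<Sum>i<n. y (Suc i) t - y i t) = y n t - w" for n t
    using sum_lessThan_telescope[of "\<lambda>i. y i t" n] by (simp add: y0)
  ultimately have "uniform_limit {0..1} (\<lambda>n t. \<Sum>i<n. y (Suc i) t - y i t) (\<lambda>t. \<Sum>i. y (Suc i) t - y i t) sequentially"
    using bound' by (intro Weierstrass_m_test)
  then have unif: "uniform_limit {0..1} (\<lambda>n t. y n t - w) (\<lambda>t. \<Sum>i. y (Suc i) t - y i t) sequentially"
    unfolding tel .
  define z where "z = (\<lambda>t. w + (\<Sum>i. y (Suc i) t - y i t))"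
  have unif: "uniform_limit {0..1} y z sequentially"
  proof -
    have "uniform_limit {0..1} (\<lambda>n t. w + (y n t - w)) z sequentially"
      unfolding z_def by (intro uniform_limit_intros unif)
    then show ?thesis by simp
  qed
  have contz: "continuous_on {0..1} z"
    by (rule uniform_limit_theorem[OF _ unif]) (auto simp: cont)
  have contYz: "continuous_on {0..1} (\<lambda>s. Y (z s))"
    by (rule continuous_on_compose2[OF contY[of UNIV] contz]) simp
  have z_eq: "z t = w + integral {0..t} (\<lambda>s. Y (z s))" if t: "t \<in> {0..1}" for t
  proof -
    have "uniform_limit {0..t} (\<lambda>n s. Y (y n s)) (\<lambda>s. Y (z s)) sequentially"
    proof (rule uniform_limitI)
      fix e :: real assume "e > 0"
      then have "\<forall>\<^sub>F n in sequentially. \<forall>s\<in>{0..1}. dist (y n s) (z s) < e / (L + 1)"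
        using L by (intro uniform_limitD[OF unif]) simp
      then show "\<forall>\<^sub>F n in sequentially. \<forall>s\<in>{0..t}. dist (Y (y n s)) (Y (z s)) < e"
      proof (rule eventually_mono, intro ballI)
        fix n s assume *: "\<forall>s\<in>{0..1}. dist (y n s) (z s) < e / (L + 1)" and "s \<in> {0..t}"
        then have "norm (y n s - z s) < e / (L + 1)"
          using t by (auto simp: dist_norm)
        then have "(L + 1) * norm (y n s - z s) < e"
          using L by (simp add: pos_less_divide_eq mult.commute)
        moreover have "L * norm (y n s - z s) \<le> (L + 1) * norm (y n s - z s)"
          by (simp add: mult_right_mono)
        ultimately show "dist (Y (y n s)) (Y (z s)) < e"
          using lip[of "y n s" "z s"] by (simp add: dist_norm)
      qed
    qed
    then obtain I J where IJ: "\<And>n. ((\<lambda>s. Y (y n s)) has_integral I n) {0..t}"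
      "((\<lambda>s. Y (z s)) has_integral J) {0..t}" "I \<longlonglongrightarrow> J"
      by (rule uniform_limit_integral[OF _ contY'[OF t]]) auto
    then have "(\<lambda>n. P (y n) t) \<longlonglongrightarrow> w + integral {0..t} (\<lambda>s. Y (z s))"
      unfolding P_def integral_unique[OF IJ(1)] integral_unique[OF IJ(2)]
      by (intro tendsto_add tendsto_const)
    moreover have "(\<lambda>n. y (Suc n) t) \<longlonglongrightarrow> z t"
      using tendsto_uniform_limitI[OF unif t] by (rule LIMSEQ_Suc)
    ultimately show ?thesis
      unfolding ySuc using LIMSEQ_unique by blast
  qed
  show thesis
  proof
    show "z 0 = w" using z_eq[of 0] by simp
    fix t :: real assume t: "t \<in> {0..1}"
    have "((\<lambda>t. w + integral {0..t} (\<lambda>s. Y (z s))) has_vector_derivative 0 + Y (z t)) (at t within {0..1})"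
      by (intro has_vector_derivative_add has_vector_derivative_const
          integral_has_vector_derivative contYz t)
    then show "(z has_vector_derivative Y (z t)) (at t within {0..1})"
      by (intro has_vector_derivative_transform[OF t z_eq, rotated]) simp
  qed
qed

section \<open>Complex hyperbolic space in flat symplectic coordinates\<close>

definition herm :: "complex ^ 'n::finite \<Rightarrow> complex ^ 'n \<Rightarrow> complex" where
  "herm x y = (\<Sum>j\<in>UNIV. x $ j * cnj (y $ j))"

lemma herm_linear:
  "herm (a - b) c = herm a c - herm b c" "herm c (a - b) = herm c a - herm c b"
  "herm (r *\<^sub>R a) c = of_real r * herm a c" "herm c (r *\<^sub>R a) = of_real r * herm c a"
  "herm c (J_std a) = - \<i> * herm c a" "herm (J_std a) c = \<i> * herm a c"
proof -
  show "herm (r *\<^sub>R a) c = of_real r * herm a c"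
    by (simp add: herm_def scaleR_conv_of_real[symmetric] scaleR_sum_right)
  show "herm c (r *\<^sub>R a) = of_real r * herm c a"
    by (simp add: herm_def scaleR_conv_of_real[symmetric] scaleR_sum_right)
qed (simp_all add: herm_def J_std_def left_diff_distrib right_diff_distrib sum_subtractf
      sum_distrib_left mult_ac sum_negf)

lemma cnj_herm: "cnj (herm a b) = herm b a"
  by (simp add: herm_def mult_ac)

lemma Re_herm: "Re (herm a b) = a \<bullet> b"
  by (simp add: herm_def inner_vec_def inner_complex_def)

lemma herm_self: "herm a a = of_real (a \<bullet> a)"
  by (rule complex_eqI) (use Re_herm[of a a] cnj_herm[of a a] in \<open>auto simp: complex_eq_iff\<close>)

definition flat_form :: "complex ^ 'n::finite \<Rightarrow> complex ^ 'n \<Rightarrow> real" where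
  "flat_form u v = - Im (herm u v)"

lemma flat_form_J: "flat_form u v = J_std u \<bullet> v"
  by (simp add: flat_form_def Re_herm[symmetric] herm_linear)

definition flat_to_hyp :: "complex ^ 'n::finite \<Rightarrow> complex ^ 'n" where
  "flat_to_hyp w = (1 / sqrt (1 + (norm w)\<^sup>2)) *\<^sub>R w"

definition flat_to_hyp_deriv :: "complex ^ 'n::finite \<Rightarrow> complex ^ 'n \<Rightarrow> complex ^ 'n" where
  "flat_to_hyp_deriv w h = (1 / sqrt (1 + (norm w)\<^sup>2)) *\<^sub>R h -
     ((w \<bullet> h) / sqrt (1 + (norm w)\<^sup>2) ^ 3) *\<^sub>R w"

lemma norm_flat_to_hyp: "1 - (norm (flat_to_hyp w))\<^sup>2 = 1 / (1 + (norm w)\<^sup>2)"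
proof -
  have "1 + (norm w)\<^sup>2 > 0" by (simp add: add_pos_nonneg)
  then show ?thesis
    by (simp add: flat_to_hyp_def power_divide power_mult_distrib field_simps)
qed

lemma flat_to_hyp_in_ball: "flat_to_hyp w \<in> ball 0 1"
proof -
  have "1 / (1 + (norm w)\<^sup>2) > 0" by (simp add: add_pos_nonneg)
  then have "(norm (flat_to_hyp w))\<^sup>2 < 1" unfolding norm_flat_to_hyp[symmetric] by simp
  then show ?thesis by (simp add: power_less_one_iff abs_square_less_1)
qed

lemma hyp_to_flat_to_hyp: "hyp_to_flat (flat_to_hyp w) = w"
proof -
  have "1 + (norm w)\<^sup>2 > 0" by (simp add: add_pos_nonneg)
  then show ?thesis
    unfolding hyp_to_flat_def norm_flat_to_hyp by (simp add: flat_to_hyp_def real_sqrt_divide)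
qed

lemma flat_to_hyp_to_flat:
  assumes "z \<in> ball 0 1" shows "flat_to_hyp (hyp_to_flat z) = z"
proof -
  have p: "1 - (norm z)\<^sup>2 > 0" using assms by (simp add: abs_square_less_1)
  have "1 + (norm (hyp_to_flat z))\<^sup>2 = 1 / (1 - (norm z)\<^sup>2)"
    using p by (simp add: hyp_to_flat_def power_divide power_mult_distrib field_simps)
  then show ?thesis
    using p unfolding flat_to_hyp_def by (simp add: hyp_to_flat_def real_sqrt_divide)
qed

lemma inv_sqrt_powr: "x > 0 \<Longrightarrow> x powr (- 1 / 2) = 1 / sqrt x" for x :: real
  by (simp add: powr_minus_divide powr_half_sqrt)

lemma C_k_on_flat_to_hyp: "C_k_on k UNIV (flat_to_hyp :: complex ^ 'n::finite \<Rightarrow> _)"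
proof (rule C_k_on_cong)
  have p: "1 + w \<bullet> w > 0" for w :: "complex ^ 'n" by (simp add: add_pos_nonneg)
  show "C_k_on k UNIV (\<lambda>w :: complex ^ 'n. ((1 + w \<bullet> w) powr (- 1 / 2)) *\<^sub>R w)"
    by (intro C_k_on_scaleR C_k_on_powr C_k_on_add C_k_on_const C_k_on_inner C_k_on_id open_UNIV p)
  show "((1 + w \<bullet> w) powr (- 1 / 2)) *\<^sub>R w = flat_to_hyp w" for w :: "complex ^ 'n"
    unfolding flat_to_hyp_def power2_norm_eq_inner inv_sqrt_powr[OF p] ..
qed simp

lemma C_k_on_hyp_to_flat: "C_k_on k (ball 0 1) (hyp_to_flat :: complex ^ 'n::finite \<Rightarrow> _)"
proof (rule C_k_on_cong)
  have p: "1 - w \<bullet> w > 0" if "w \<in> ball 0 1" for w :: "complex ^ 'n"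
    using that by (simp add: dot_square_norm abs_square_less_1)
  then show "C_k_on k (ball 0 1) (\<lambda>w :: complex ^ 'n. ((1 - w \<bullet> w) powr (- 1 / 2)) *\<^sub>R w)"
    by (intro C_k_on_scaleR C_k_on_powr C_k_on_diff C_k_on_const C_k_on_inner C_k_on_id open_ball)
  show "((1 - w \<bullet> w) powr (- 1 / 2)) *\<^sub>R w = hyp_to_flat w" if "w \<in> ball 0 1" for w :: "complex ^ 'n"
    unfolding hyp_to_flat_def power2_norm_eq_inner inv_sqrt_powr[OF p[OF that]] ..
qed simp

lemma flat_to_hyp_has_derivative: "(flat_to_hyp has_derivative flat_to_hyp_deriv w) (at w)"
proof -
  define E where "E = 1 + w \<bullet> w"
  have E: "E > 0" by (simp add: E_def add_pos_nonneg)
  have "((\<lambda>w. (1 / sqrt (1 + w \<bullet> w)) *\<^sub>R w) has_derivative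
      (\<lambda>h. (1 / sqrt E) *\<^sub>R h - ((w \<bullet> h) / sqrt E ^ 3) *\<^sub>R w)) (at w)"
    using E unfolding E_def
    by (auto intro!: derivative_eq_intros
        simp: fun_eq_iff field_simps inner_commute power2_eq_square power3_eq_cube)
  then show ?thesis
    unfolding E_def flat_to_hyp_def[abs_def] flat_to_hyp_deriv_def[abs_def] power2_norm_eq_inner .
qed

text \<open>The real part of this identity is the metric and the imaginary part the Kaehler form in
  flat coordinates. The correction terms on the right are real: this is why the map is symplectic,
  but not isometric.\<close>
lemma herm_flat_to_hyp:
  fixes w h k :: "complex ^ 'n::finite"
  defines "z \<equiv> flat_to_hyp w" and "s \<equiv> 1 - (norm (flat_to_hyp w))\<^sup>2"
    and "u \<equiv> flat_to_hyp_deriv w h" and "v \<equiv> flat_to_hyp_deriv w k"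
  shows "herm u v / of_real s + herm u z * herm z v / of_real (s\<^sup>2) =
    herm h k - of_real ((w \<bullet> h) * (w \<bullet> k) / (1 + w \<bullet> w)) + of_real (Im (herm h w) * Im (herm k w))"
proof -
  define q where "q = complex_of_real (sqrt (1 + w \<bullet> w))"
  define a where "a = complex_of_real (w \<bullet> h)"
  define a' where "a' = complex_of_real (w \<bullet> k)"
  define b where "b = complex_of_real (Im (herm h w))"
  define b' where "b' = complex_of_real (Im (herm k w))"
  define X where "X = herm h k"
  have pos: "1 + w \<bullet> w > 0" by (simp add: add_pos_nonneg)
  have q0: "q \<noteq> 0" using pos unfolding q_def by (metis of_real_eq_0_iff real_sqrt_gt_zero less_irrefl)
  have q2: "q\<^sup>2 = complex_of_real (1 + w \<bullet> w)"
    unfolding q_def of_real_power[symmetric] using pos by simp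
  have hw: "herm h w = a + \<i> * b" "herm w h = a - \<i> * b" "herm k w = a' + \<i> * b'" "herm w k = a' - \<i> * b'"
    using Re_herm[of h w] Re_herm[of w h] Re_herm[of k w] Re_herm[of w k] cnj_herm[of h w] cnj_herm[of k w]
    by (auto simp: a_def b_def a'_def b'_def complex_eq_iff inner_commute)
  have ww: "herm w w = q\<^sup>2 - 1" by (simp add: q2 herm_self)
  have z: "z = (1 / sqrt (1 + w \<bullet> w)) *\<^sub>R w" by (simp add: z_def flat_to_hyp_def power2_norm_eq_inner)
  have u: "u = (1 / sqrt (1 + w \<bullet> w)) *\<^sub>R h - ((w \<bullet> h) / sqrt (1 + w \<bullet> w) ^ 3) *\<^sub>R w"
    and v: "v = (1 / sqrt (1 + w \<bullet> w)) *\<^sub>R k - ((w \<bullet> k) / sqrt (1 + w \<bullet> w) ^ 3) *\<^sub>R w"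
    by (simp_all add: u_def v_def flat_to_hyp_deriv_def power2_norm_eq_inner)
  have r: "complex_of_real (1 / sqrt (1 + w \<bullet> w)) = 1 / q"
    "complex_of_real ((w \<bullet> h) / sqrt (1 + w \<bullet> w) ^ 3) = a / q ^ 3"
    "complex_of_real ((w \<bullet> k) / sqrt (1 + w \<bullet> w) ^ 3) = a' / q ^ 3"
    by (simp_all add: q_def a_def a'_def)
  have s: "complex_of_real s = 1 / q\<^sup>2"
    unfolding s_def norm_flat_to_hyp q2 by (simp add: power2_norm_eq_inner)
  have uv: "herm u v = X / q\<^sup>2 - a' * (a + \<i> * b) / q ^ 4 - a * (a' - \<i> * b') / q ^ 4 + a * a' * (q\<^sup>2 - 1) / q ^ 6"
    unfolding u v herm_linear r hw ww X_def[symmetric] using q0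
    by (simp add: field_simps eval_nat_numeral)
  have uz: "herm u z = (a + \<i> * b * q\<^sup>2) / q ^ 4"
    unfolding u z herm_linear r hw ww using q0 by (simp add: field_simps eval_nat_numeral)
  have zv: "herm z v = (a' - \<i> * b' * q\<^sup>2) / q ^ 4"
    unfolding v z herm_linear r hw ww using q0 by (simp add: field_simps eval_nat_numeral)
  have "herm u v / of_real s + herm u z * herm z v / of_real (s\<^sup>2) = X - a * a' / q\<^sup>2 + b * b'"
    unfolding of_real_power s uv uz zv using q0 by (simp add: field_simps eval_nat_numeral)
  then show ?thesis
    by (simp add: X_def a_def a'_def b_def b'_def q2)
qed

text \<open>The map is a symplectomorphism onto the standard
  \<open>\<complex>\<^sup>n\<close>.\<close>
lemma kaehler_form_flat:
  "kaehler_form (flat_to_hyp w) (flat_to_hyp_deriv w h) (flat_to_hyp_deriv w k) = flat_form h k"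
  unfolding kaehler_form_eq(2)[OF flat_to_hyp_in_ball] herm_def[symmetric] herm_flat_to_hyp
  by (simp add: flat_form_def)

lemma hyp_metric_flat:
  "hyp_metric (flat_to_hyp w) (flat_to_hyp_deriv w h) (flat_to_hyp_deriv w k) =
     h \<bullet> k - (w \<bullet> h) * (w \<bullet> k) / (1 + w \<bullet> w) + Im (herm h w) * Im (herm k w)"
proof -
  let ?z = "flat_to_hyp w" and ?u = "flat_to_hyp_deriv w h" and ?v = "flat_to_hyp_deriv w k"
  let ?s = "1 - (norm (flat_to_hyp w))\<^sup>2"
  let ?Q = "herm ?u ?v / of_real ?s + herm ?u ?z * herm ?z ?v / of_real (?s\<^sup>2)"
  have J: "- Im (- \<i> * c / d + b * (- \<i> * e) / g) = Re (c / d + b * e / g)" for b c d e g :: complex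
  proof -
    have "- \<i> * c / d + b * (- \<i> * e) / g = - \<i> * (c / d + b * e / g)"
      by (simp add: distrib_left)
    then show ?thesis by simp
  qed
  have "hyp_metric ?z ?u ?v = Re ?Q"
    unfolding hyp_metric_def kaehler_form_eq(2)[OF flat_to_hyp_in_ball] herm_def[symmetric]
      herm_linear by (rule J)
  then show ?thesis
    unfolding herm_flat_to_hyp by (simp add: Re_herm)
qed

text \<open>The partial derivatives are continuous with compact support, hence bounded.\<close>
lemma compact_support_lipschitz:
  fixes Y :: "'a::euclidean_space \<Rightarrow> 'b::real_normed_vector"
  assumes "C_k_on (Suc 0) UNIV Y" "compact K" "\<And>x. x \<notin> K \<Longrightarrow> Y x = 0"
  obtains L where "\<And>x y. norm (Y x - Y y) \<le> L * norm (x - y)"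
proof -
  let ?D = "\<lambda>x. frechet_derivative Y (at x)"
  have D: "(Y has_derivative ?D x) (at x)" for x
    by (rule C_k_on_has_derivative[OF assms(1)]) auto
  have D0: "?D x v = 0" if "x \<notin> K" for x v
  proof -
    have "(Y has_derivative (\<lambda>_. 0)) (at x)"
      by (rule has_derivative_transform_within_open[of "\<lambda>_. 0" _ _ _ "- K"])
        (use assms that in \<open>auto intro: compact_imp_closed\<close>)
    then show ?thesis using frechet_derivative_at by metis
  qed
  have "\<exists>B. \<forall>x. norm (?D x b) \<le> B" for b
  proof -
    have "compact ((\<lambda>x. ?D x b) ` K)"
      using assms(1,2) by (intro compact_continuous_image) (auto intro: continuous_on_subset)
    then obtain B where "\<forall>x\<in>K. norm (?D x b) \<le> B"
      using compact_imp_bounded[of "(\<lambda>x. ?D x b) ` K"] unfolding bounded_iff by blast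
    then have "norm (?D x b) \<le> max B 0" for x
      using D0[of x b] by (cases "x \<in> K") (auto simp: le_max_iff_disj)
    then show ?thesis by blast
  qed
  then obtain B where B: "\<And>b x. norm (?D x b) \<le> B b" by metis
  have on: "onorm (?D x) \<le> (\<Sum>b\<in>Basis. B b)" for x
  proof (rule onorm_bound)
    show "0 \<le> (\<Sum>b\<in>Basis. B b)"
      using B norm_ge_zero order_trans by (intro sum_nonneg) blast
    fix v
    interpret bounded_linear "?D x" using D by (rule has_derivative_bounded_linear)
    have "?D x (\<Sum>b\<in>Basis. (v \<bullet> b) *\<^sub>R b) = (\<Sum>b\<in>Basis. (v \<bullet> b) *\<^sub>R ?D x b)"
      unfolding sum scaleR ..
    then have "norm (?D x v) \<le> (\<Sum>b\<in>Basis. norm ((v \<bullet> b) *\<^sub>R ?D x b))"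
      unfolding euclidean_representation by (simp only: norm_sum)
    also have "\<dots> \<le> (\<Sum>b\<in>Basis. norm v * B b)"
      using B Basis_le_norm by (intro sum_mono) (auto intro!: mult_mono)
    finally show "norm (?D x v) \<le> (\<Sum>b\<in>Basis. B b) * norm v"
      by (simp add: sum_distrib_left mult.commute)
  qed
  show thesis
    by (rule that, rule differentiable_bound[OF convex_UNIV D on]) auto
qed

lemma J_std_bounded_linear: "bounded_linear (J_std :: complex ^ 'n::finite \<Rightarrow> _)"
  by (rule linear_conv_bounded_linear[THEN iffD1])
     (auto intro!: linearI simp: J_std_def vec_eq_iff algebra_simps)

text \<open>Multiplying \<open>G\<close> by a cutoff function that is \<open>1\<close> near
  \<open>K\<close> gives a compactly supported Hamiltonian. Its flow on \<open>T\<close> is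
  \<open>y\<close>, since these curves stay where the cutoff function is \<open>1\<close>. For the
  other initial values any solution will do: \<open>is_flow\<close> only asks for a solution through
  each point.\<close>
lemma hamiltonian_extension:
  fixes G :: "complex ^ 'n::finite \<Rightarrow> real" and y :: "real \<Rightarrow> complex ^ 'n \<Rightarrow> complex ^ 'n"
  assumes W: "open W" and G: "\<And>k. C_k_on k W G" and K: "compact K" "K \<subseteq> W"
    and y0: "\<And>w. w \<in> T \<Longrightarrow> y 0 w = w"
    and yK: "\<And>w t. w \<in> T \<Longrightarrow> t \<in> {0..1} \<Longrightarrow> y t w \<in> K"
    and yd: "\<And>w t. w \<in> T \<Longrightarrow> t \<in> {0..1} \<Longrightarrow>
        ((\<lambda>s. y s w) has_vector_derivative y' t w) (at t within {0..1})"
    and yG: "\<And>w t h. w \<in> T \<Longrightarrow> t \<in> {0..1} \<Longrightarrow>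
        flat_form (y' t w) h = frechet_derivative G (at (y t w)) h"
  obtains \<Psi> where "\<Psi> \<in> Ham_c" "\<And>w. w \<in> T \<Longrightarrow> \<Psi> (flat_to_hyp w) = flat_to_hyp (y 1 w)"
proof -
  obtain \<phi> :: "complex ^ 'n \<Rightarrow> real" and K' V where \<phi>:
    "\<And>k. C_k_on k UNIV \<phi>" "compact K'" "K' \<subseteq> W" "\<And>x. x \<notin> K' \<Longrightarrow> \<phi> x = 0"
    "open V" "K \<subseteq> V" "V \<subseteq> W" "\<And>x. x \<in> V \<Longrightarrow> \<phi> x = 1"
    using smooth_cutoff[OF K(1) W K(2)] by blast
  define H where "H = (\<lambda>w. \<phi> w * (if w \<in> W then G w else 0))"
  have oK': "open (- K')" using \<phi>(2) by (simp add: compact_imp_closed open_Compl)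
  have HC: "C_k_on k UNIV H" for k
  proof -
    have "C_k_on k W (\<lambda>w. \<phi> w * G w)"
      by (intro C_k_on_mult W G C_k_on_subset[OF \<phi>(1)]) simp
    then have "C_k_on k W H"
      by (rule C_k_on_cong[OF W, rotated]) (simp add: H_def)
    moreover have "C_k_on k (- K') H"
      by (rule C_k_on_cong[OF oK' _ C_k_on_const[of _ _ 0]]) (simp add: H_def \<phi>(4))
    moreover have "W \<union> - K' = UNIV" using \<phi>(3) by blast
    ultimately show ?thesis using C_k_on_Un[OF W oK'] by metis
  qed
  let ?DH = "\<lambda>w. frechet_derivative H (at w)"
  have DH: "(H has_derivative ?DH w) (at w)" for w
    by (rule C_k_on_has_derivative[OF HC[of "Suc 0"]]) auto
  define Y where "Y = (\<lambda>w. - J_std (\<Sum>b\<in>Basis. ?DH w b *\<^sub>R b))"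
  have JJ: "J_std (- J_std v) = v" for v :: "complex ^ 'n"
    by (simp add: J_std_def vec_eq_iff)
  have YH: "flat_form (Y w) h = ?DH w h" for w h
  proof -
    interpret bounded_linear "?DH w" using DH by (rule has_derivative_bounded_linear)
    have "?DH w (\<Sum>b\<in>Basis. (h \<bullet> b) *\<^sub>R b) = (\<Sum>b\<in>Basis. (h \<bullet> b) *\<^sub>R ?DH w b)"
      unfolding sum scaleR ..
    then show ?thesis
      unfolding flat_form_J Y_def JJ euclidean_representation
      by (simp add: inner_sum_left inner_commute[of h] mult.commute)
  qed
  have Y_unique: "v = Y w" if "\<And>h. flat_form v h = ?DH w h" for v w
  proof -
    have "J_std v \<bullet> h = J_std (Y w) \<bullet> h" for h
      using that YH unfolding flat_form_J by simp
    then have "J_std v = J_std (Y w)" using vector_eq_rdot by blast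
    then show ?thesis by (simp add: J_std_def vec_eq_iff)
  qed
  have "C_k_on (Suc (Suc 0)) UNIV H" by (rule HC)
  then have "C_k_on (Suc 0) UNIV (\<lambda>w. ?DH w b)" for b
    by (subst (asm) C_k_on.simps) blast
  then have "C_k_on (Suc 0) UNIV (\<lambda>w. - J_std (\<Sum>b\<in>Basis. ?DH w b *\<^sub>R b))"
    by (intro C_k_on_linear[OF open_UNIV bounded_linear_minus[OF J_std_bounded_linear]]
        C_k_on_sum C_k_on_scaleR C_k_on_const open_UNIV)
  then have YC: "C_k_on (Suc 0) UNIV Y" by (simp only: Y_def)
  have Y0: "Y w = 0" if "w \<notin> K'" for w
  proof -
    have "(H has_derivative (\<lambda>_. 0)) (at w)"
      by (rule has_derivative_transform_within_open[OF _ oK', of "\<lambda>_. 0"])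
        (use that in \<open>auto simp: H_def \<phi>(4)\<close>)
    then have "?DH w = (\<lambda>_. 0)" using frechet_derivative_at by metis
    then show ?thesis by (simp add: Y_def J_std_def vec_eq_iff)
  qed
  obtain L where "\<And>v w. norm (Y v - Y w) \<le> L * norm (v - w)"
    using compact_support_lipschitz[OF YC \<phi>(2) Y0] by blast
  then have "\<exists>x. x 0 = w \<and> (\<forall>t\<in>{0..1}. (x has_vector_derivative Y (x t)) (at t within {0..1}))" for w
    using lipschitz_ode_solution[of Y L w] by metis
  then obtain x where x: "\<And>w. x w 0 = w"
    "\<And>w t. t \<in> {0..1} \<Longrightarrow> (x w has_vector_derivative Y (x w t)) (at t within {0..1})"
    by metis
  \<comment> \<open>On \<open>T\<close> the given curves, elsewhere arbitrary solutions.\<close>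
  define S where "S = (\<lambda>t w. if w \<in> T then y t w else x w t)"
  have S: "S 0 w = w" "t \<in> {0..1} \<Longrightarrow> ((\<lambda>t. S t w) has_vector_derivative Y (S t w)) (at t within {0..1})" for w t
  proof -
    show "S 0 w = w" by (simp add: S_def x(1) y0)
    assume t: "t \<in> {0..1}"
    show "((\<lambda>t. S t w) has_vector_derivative Y (S t w)) (at t within {0..1})"
    proof (cases "w \<in> T")
      case True
      have V: "y t w \<in> V" using yK[OF True t] \<phi>(6) by blast
      then have "(G has_derivative ?DH (y t w)) (at (y t w))"
        using \<phi>(7,8) by (intro has_derivative_transform_within_open[OF DH \<phi>(5)]) (auto simp: H_def)
      then have "frechet_derivative G (at (y t w)) = ?DH (y t w)"
        using frechet_derivative_at by metis
      then have "y' t w = Y (y t w)"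
        using yG[OF True t] by (intro Y_unique) simp
      then show ?thesis using yd[OF True t] True by (simp add: S_def)
    next
      case False
      then show ?thesis using x(2)[OF t, of w] by (simp add: S_def)
    qed
  qed
  define f where "f = (\<lambda>p :: real \<times> (complex ^ 'n). H (hyp_to_flat (snd p)))"
  define X where "X = (\<lambda>(t::real) z. flat_to_hyp_deriv (hyp_to_flat z) (Y (hyp_to_flat z)))"
  define F where "F = (\<lambda>t z. flat_to_hyp (S t (hyp_to_flat z)))"
  have "smooth_on ({0..1} \<times> ball 0 1) f"
  proof -
    have o: "open ((UNIV :: real set) \<times> ball (0 :: complex ^ 'n) 1)" by (intro open_Times) auto
    have "C_k_on k (UNIV \<times> ball 0 1) (\<lambda>p :: real \<times> (complex ^ 'n). hyp_to_flat (snd p))" for k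
      by (rule C_k_on_compose[OF o open_ball _ C_k_on_hyp_to_flat
            C_k_on_linear[OF o bounded_linear_snd C_k_on_id[OF o]]]) auto
    then have "C_k_on k (UNIV \<times> ball 0 1) f" for k
      unfolding f_def by (intro C_k_on_compose[OF o open_UNIV _ HC]) simp_all
    then show ?thesis
      unfolding smooth_on_def using o by (metis SigmaE SigmaI UNIV_I)
  qed
  moreover have "compact ({0..1::real} \<times> flat_to_hyp ` K')"
    using C_k_on_flat_to_hyp[of 0] \<phi>(2)
    by (intro compact_Times compact_continuous_image) (auto intro: continuous_on_subset)
  moreover have "{0..1::real} \<times> flat_to_hyp ` K' \<subseteq> {0..1} \<times> ball 0 1"
    using flat_to_hyp_in_ball by blast
  moreover have "\<forall>p\<in>{0..1} \<times> ball 0 1 - {0..1} \<times> flat_to_hyp ` K'. f p = 0"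
  proof
    fix p :: "real \<times> (complex ^ 'n)"
    assume "p \<in> {0..1} \<times> ball 0 1 - {0..1} \<times> flat_to_hyp ` K'"
    then have "snd p \<in> ball 0 1" "snd p \<notin> flat_to_hyp ` K'" by auto
    then have "hyp_to_flat (snd p) \<notin> K'" using flat_to_hyp_to_flat by (metis imageI)
    then show "f p = 0" by (simp add: f_def H_def \<phi>(4))
  qed
  moreover have "hamiltonian_vector_field f X"
    unfolding hamiltonian_vector_field_def
  proof (intro ballI allI)
    fix t :: real and z v :: "complex ^ 'n" assume z: "z \<in> ball 0 1"
    let ?w = "hyp_to_flat z" and ?k = "frechet_derivative hyp_to_flat (at z) v"
    have d: "(hyp_to_flat has_derivative frechet_derivative hyp_to_flat (at z)) (at z)"
      by (rule C_k_on_has_derivative[OF C_k_on_hyp_to_flat open_ball z])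
    have "((\<lambda>z. flat_to_hyp (hyp_to_flat z)) has_derivative
        (\<lambda>v. flat_to_hyp_deriv ?w (frechet_derivative hyp_to_flat (at z) v))) (at z)"
      by (rule has_derivative_compose[OF d flat_to_hyp_has_derivative])
    then have "((\<lambda>z. z) has_derivative
        (\<lambda>v. flat_to_hyp_deriv ?w (frechet_derivative hyp_to_flat (at z) v))) (at z)"
      by (rule has_derivative_transform_within_open[OF _ open_ball z]) (simp add: flat_to_hyp_to_flat)
    then have k: "flat_to_hyp_deriv ?w ?k = v"
      using has_derivative_unique[OF _ has_derivative_ident] by metis
    have "((\<lambda>w. f (t, w)) has_derivative (\<lambda>v. ?DH ?w (frechet_derivative hyp_to_flat (at z) v))) (at z)"
      unfolding f_def snd_conv by (rule has_derivative_compose[OF d DH])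
    then have "frechet_derivative (\<lambda>w. f (t, w)) (at z) v = ?DH ?w ?k"
      using frechet_derivative_at by metis
    also have "\<dots> = kaehler_form (flat_to_hyp ?w) (flat_to_hyp_deriv ?w (Y ?w)) (flat_to_hyp_deriv ?w ?k)"
      by (simp add: kaehler_form_flat YH)
    finally show "kaehler_form z (X t z) v = frechet_derivative (\<lambda>w. f (t, w)) (at z) v"
      using z by (simp add: k X_def flat_to_hyp_to_flat)
  qed
  moreover have "is_flow X F"
    unfolding is_flow_def
  proof (intro ballI conjI)
    fix z :: "complex ^ 'n" assume z: "z \<in> ball 0 1"
    show "F 0 z = z" using z by (simp add: F_def S(1) flat_to_hyp_to_flat)
    fix t :: real assume t: "t \<in> {0..1}"
    show "F t z \<in> ball 0 1" unfolding F_def by (rule flat_to_hyp_in_ball)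
    show "((\<lambda>s. F s z) has_vector_derivative X t (F t z)) (at t within {0..1})"
      using vector_derivative_diff_chain_within[OF S(2)[OF t]
          has_derivative_at_withinI[OF flat_to_hyp_has_derivative], of "hyp_to_flat z"]
      unfolding F_def X_def hyp_to_flat_to_hyp by (simp add: o_def)
  qed
  ultimately have "F 1 \<in> Ham_c" unfolding Ham_c_def by blast
  then show thesis
    by (rule that) (simp add: F_def S_def hyp_to_flat_to_hyp)
qed

section \<open>Volumes of tori that are graphs over a product torus\<close>

text \<open>Multiples of the row \<open>b\<close> can be subtracted from the other rows, which turns
  them into unit vectors.\<close>
lemma det_replaced_row:
  fixes a :: "'n::finite \<Rightarrow> 'a::field" and b :: "'a ^ 'n"
  assumes "finite S" "k \<notin> S"
  shows "det (\<chi> i. if i = k then b else if i \<in> S then axis i 1 + a i *s b else axis i 1 :: 'a ^ 'n ^ 'n) = b $ k"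
  using assms
proof (induction S)
  case empty
  have r: "row i (mat 1 :: 'a ^ 'n ^ 'n) = axis i 1" for i
    by (simp add: row_def mat_def axis_def vec_eq_iff)
  show ?case
    using cramer_lemma_transpose[of k b "mat 1 :: 'a ^ 'n ^ 'n", unfolded r basis_expansion] by (simp cong: if_cong)
next
  case (insert l S)
  let ?A = "\<chi> i. if i = k then b else if i \<in> S then axis i 1 + a i *s b else axis i 1 :: 'a ^ 'n ^ 'n"
  have "l \<noteq> k" using insert by auto
  then have "(\<chi> i. if i = k then b else if i \<in> insert l S then axis i 1 + a i *s b else axis i 1) =
      (\<chi> i. if i = l then row l ?A + a l *s row k ?A else row i ?A)"
    using insert.hyps by (auto simp: vec_eq_iff row_def)
  then show ?case
    using det_row_operation[OF \<open>l \<noteq> k\<close>, of ?A "a l"] insert by simp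
qed

text \<open>By multilinearity in the rows, replacing one unit row \<open>axis k 1\<close> by
  \<open>axis k 1 + a k *s b\<close> adds \<open>a k * b k\<close> to the determinant.\<close>
lemma det_identity_plus_rank_one:
  fixes a b :: "'n::finite \<Rightarrow> 'a::field"
  shows "det (\<chi> i j. (if i = j then 1 else 0) + a i * b j :: 'a ^ 'n ^ 'n) = 1 + (\<Sum>i\<in>UNIV. a i * b i)"
proof -
  let ?b = "\<chi> j. b j"
  have *: "det (\<chi> i. if i \<in> S then axis i 1 + a i *s ?b else axis i 1 :: 'a ^ 'n ^ 'n) = 1 + (\<Sum>i\<in>S. a i * b i)"
    if "finite S" for S
    using that
  proof (induction S)
    case empty
    have "(\<chi> i. axis i 1) = (mat 1 :: 'a ^ 'n ^ 'n)"
      by (simp add: mat_def axis_def vec_eq_iff)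
    then show ?case by simp
  next
    case (insert k S)
    let ?c = "\<lambda>i. if i \<in> S then axis i 1 + a i *s ?b else axis i 1"
    have "det (\<chi> i. if i \<in> insert k S then axis i 1 + a i *s ?b else axis i 1) =
        det (\<chi> i. if i = k then axis i 1 + a k *s ?b else ?c i)"
      by (intro arg_cong[where f=det]) (auto simp: vec_eq_iff)
    also have "\<dots> = det (\<chi> i. if i = k then axis i 1 else ?c i) + a k * det (\<chi> i. if i = k then ?b else ?c i)"
      using det_row_add[of k "\<lambda>i. axis i 1" "\<lambda>i. a k *s ?b" ?c] det_row_mul[of k "a k" "\<lambda>i. ?b" ?c]
      by simp
    also have "(\<chi> i. if i = k then axis i 1 else ?c i) = (\<chi> i. ?c i)"
      using insert.hyps by (auto simp: vec_eq_iff)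
    finally show ?case
      using insert det_replaced_row[OF insert.hyps, of ?b a] by simp
  qed
  have "(\<chi> i. if i \<in> UNIV then axis i 1 + a i *s ?b else axis i 1) =
      (\<chi> i j. (if i = j then 1 else 0) + a i * b j)"
    by (auto simp: vec_eq_iff axis_def)
  then show ?thesis using *[OF finite[of UNIV]] by (simp only:)
qed

text \<open>The matrix is the product of the diagonal matrix with two perturbations of the identity
  of rank one: \<open>1 x\<^sup>T\<close>, and \<open>y m\<^sup>T\<close> where \<open>y\<close>
  solves \<open>diag(x) (I + 1 x\<^sup>T) y = c m\<close>.\<close>
lemma det_diagonal_plus_rank_two:
  fixes x m :: "'n::finite \<Rightarrow> real"
  assumes x: "\<And>i. x i > 0"
  shows "det (\<chi> i j. (if i = j then x i else 0) + x i * x j + c * (m i * m j) :: real ^ 'n ^ 'n) =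
    (\<Prod>i\<in>UNIV. x i) * (1 + (\<Sum>i\<in>UNIV. x i)) *
    (1 + c * ((\<Sum>i\<in>UNIV. (m i)\<^sup>2 / x i) - (\<Sum>i\<in>UNIV. m i)\<^sup>2 / (1 + (\<Sum>i\<in>UNIV. x i))))"
proof -
  define S where "S = (\<Sum>i\<in>UNIV. x i)"
  define \<sigma> where "\<sigma> = (\<Sum>i\<in>UNIV. m i)"
  define y where "y = (\<lambda>i. c * (m i / x i - \<sigma> / (1 + S)))"
  let ?D = "\<chi> i j. if i = j then x i else 0 :: real ^ 'n ^ 'n"
  let ?A = "\<chi> i j. (if i = j then 1 else 0) + 1 * x j :: real ^ 'n ^ 'n"
  let ?B = "\<chi> i j. (if i = j then 1 else 0) + y i * m j :: real ^ 'n ^ 'n"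
  have S: "1 + S > 0" unfolding S_def using x by (intro add_pos_nonneg sum_nonneg) (auto intro: less_imp_le)
  have xy: "(\<Sum>k\<in>UNIV. x k * y k) = c * \<sigma> / (1 + S)"
  proof -
    have "x k * y k = c * (m k - x k * (\<sigma> / (1 + S)))" for k
      using x[of k] by (simp add: y_def algebra_simps)
    then have "(\<Sum>k\<in>UNIV. x k * y k) = c * (\<sigma> - S * (\<sigma> / (1 + S)))"
      by (simp add: sum_distrib_left[symmetric] sum_subtractf sum_distrib_right[symmetric] S_def \<sigma>_def
          del: times_divide_eq_right)
    then show ?thesis using S by (simp add: field_simps)
  qed
  have AB: "(?A ** ?B) $ i $ j = (if i = j then 1 else 0) + x j + c * m i * m j / x i" for i j
  proof -
    have "(?A ** ?B) $ i $ j = (\<Sum>k\<in>UNIV. ((if i = k then 1 else 0) + x k) * ((if k = j then 1 else 0) + y k * m j))"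
      by (simp add: matrix_matrix_mult_def)
    also have "\<dots> = (\<Sum>k\<in>UNIV. if i = k then (if k = j then 1 else 0) + y k * m j else 0) +
        (\<Sum>k\<in>UNIV. if k = j then x k else 0) + (\<Sum>k\<in>UNIV. x k * y k) * m j"
      unfolding sum_distrib_right sum.distrib[symmetric]
      by (intro sum.cong) (auto simp: algebra_simps)
    also have "\<dots> = (if i = j then 1 else 0) + x j + c * m i * m j / x i"
      unfolding xy by (simp add: y_def algebra_simps)
    finally show ?thesis .
  qed
  have "(?D ** (?A ** ?B)) $ i $ j = (if i = j then x i else 0) + x i * x j + c * (m i * m j)" for i j
  proof -
    have "(?D ** (?A ** ?B)) $ i $ j = (\<Sum>k\<in>UNIV. (if i = k then x i * (?A ** ?B) $ k $ j else 0))"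
      unfolding matrix_matrix_mult_def[of ?D] by (simp add: if_distrib[of "\<lambda>a. a * _"] cong: if_cong)
    also have "\<dots> = x i * (?A ** ?B) $ i $ j" by simp
    finally show ?thesis unfolding AB using x[of i] by (auto simp: algebra_simps)
  qed
  then have "(\<chi> i j. (if i = j then x i else 0) + x i * x j + c * (m i * m j)) = ?D ** (?A ** ?B)"
    by (simp add: vec_eq_iff)
  moreover have "det ?D = (\<Prod>i\<in>UNIV. x i)"
    by (subst det_diagonal) auto
  moreover have "1 + (\<Sum>i\<in>UNIV. y i * m i) = 1 + c * ((\<Sum>i\<in>UNIV. (m i)\<^sup>2 / x i) - \<sigma>\<^sup>2 / (1 + S))"
  proof -
    have "y i * m i = c * ((m i)\<^sup>2 / x i - m i * (\<sigma> / (1 + S)))" for i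
      by (simp add: y_def algebra_simps power2_eq_square)
    then have "(\<Sum>i\<in>UNIV. y i * m i) = c * ((\<Sum>i\<in>UNIV. (m i)\<^sup>2 / x i) - \<sigma> * (\<sigma> / (1 + S)))"
      by (simp add: sum_distrib_left[symmetric] sum_subtractf sum_distrib_right[symmetric] \<sigma>_def
          del: times_divide_eq_right)
    then show ?thesis by (simp add: power2_eq_square)
  qed
  ultimately show ?thesis
    unfolding S_def[symmetric] \<sigma>_def[symmetric]
    by (simp only: det_mul det_identity_plus_rank_one) (simp add: S_def)
qed

definition phase :: "('n::finite \<Rightarrow> real) \<Rightarrow> real ^ 'n \<Rightarrow> real" where
  "phase m \<theta> = (\<Sum>j\<in>UNIV. m j * \<theta> $ j)"

text \<open>In action-angle coordinates \<open>(|z\<^sub>l|\<^sup>2 / 2, \<theta>\<^sub>l)\<close>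
  this is the graph of the differential of \<open>e sin \<circ> phase m\<close> over the product
  torus with squared radii \<open>x\<close>. For \<open>e = 0\<close> it is the product torus
  itself.\<close>
definition wave_torus :: "('n::finite \<Rightarrow> real) \<Rightarrow> ('n \<Rightarrow> real) \<Rightarrow> real \<Rightarrow> real ^ 'n \<Rightarrow> complex ^ 'n" where
  "wave_torus x m e \<theta> = (\<chi> j. of_real (sqrt (x j + 2 * m j * (e * cos (phase m \<theta>)))) * cis (\<theta> $ j))"

text \<open>The volume density of a wave torus, with \<open>a = e cos \<psi>\<close> and \<open>b =
  e sin \<psi>\<close> separated. The number \<open>Q\<close> is the squared length of
  \<open>m\<close> in the Hessian metric on the space of actions.\<close>
definition vol_density :: "('n::finite \<Rightarrow> real) \<Rightarrow> ('n \<Rightarrow> real) \<Rightarrow> real \<Rightarrow> real \<Rightarrow> real" where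
  "vol_density x m a b =
    (let X = \<lambda>j. x j + 2 * m j * a; S = 1 + (\<Sum>j\<in>UNIV. X j);
         Q = (\<Sum>j\<in>UNIV. (m j)\<^sup>2 / X j) - (\<Sum>j\<in>UNIV. m j)\<^sup>2 / S
     in sqrt ((\<Prod>j\<in>UNIV. X j) * S * (1 + b\<^sup>2 * Q\<^sup>2)))"

text \<open>A fundamental domain for the angles, half open so that the parametrizations are
  injective.\<close>
definition angle_box :: "(real ^ 'n::finite) set" where
  "angle_box = {\<theta>. \<forall>j. 0 \<le> \<theta> $ j \<and> \<theta> $ j < 2 * pi}"

lemma phase_linear: "bounded_linear (phase m)"
  unfolding phase_def by (intro bounded_linear_sum bounded_linear_mult_right[THEN bounded_linear_compose] bounded_linear_vec_nth)

lemma phase_axis: "phase m (axis i t) = m i * t"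
  unfolding phase_def axis_def by (simp add: if_distrib[of "\<lambda>t. _ * t"] cong: if_cong)

lemma has_derivative_vec_lambda:
  fixes f :: "'n::finite \<Rightarrow> 'a::euclidean_space \<Rightarrow> 'b::euclidean_space"
  assumes "\<And>i. (f i has_derivative f' i) (at a within S)"
  shows "((\<lambda>x. \<chi> i. f i x) has_derivative (\<lambda>h. \<chi> i. f' i h)) (at a within S)"
proof (subst has_derivative_componentwise_within, intro ballI)
  fix b :: "'b ^ 'n" assume "b \<in> Basis"
  then obtain k c where "b = axis k c" by (auto simp: Basis_vec_def)
  then show "((\<lambda>x. (\<chi> i. f i x) \<bullet> b) has_derivative (\<lambda>h. (\<chi> i. f' i h) \<bullet> b)) (at a within S)"
    using has_derivative_inner_left[OF assms[of k], of c] by (simp add: inner_axis)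
qed

text \<open>The bound keeps the squared radii positive for all values of the phase.\<close>
locale wave =
  fixes x m :: "'n::finite \<Rightarrow> real" and e :: real
  assumes pos: "\<bar>a\<bar> \<le> \<bar>e\<bar> \<Longrightarrow> x j + 2 * m j * a > 0"
begin

definition sq_radius :: "real ^ 'n \<Rightarrow> 'n \<Rightarrow> real" where
  "sq_radius \<theta> j = x j + 2 * m j * (e * cos (phase m \<theta>))"

lemma sq_radius_pos: "sq_radius \<theta> j > 0"
  unfolding sq_radius_def by (rule pos) (simp add: abs_mult mult_left_le)

definition wave_deriv :: "real ^ 'n \<Rightarrow> real ^ 'n \<Rightarrow> complex ^ 'n" where
  "wave_deriv \<theta> \<xi> = (\<chi> j. cis (\<theta> $ j) * Complex (- m j * (e * sin (phase m \<theta>)) * phase m \<xi> / sqrt (sq_radius \<theta> j))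
     (sqrt (sq_radius \<theta> j) * \<xi> $ j))"

lemma wave_torus_sq_radius: "wave_torus x m e \<theta> = (\<chi> j. cis (\<theta> $ j) * Complex (sqrt (sq_radius \<theta> j)) 0)"
  by (simp add: wave_torus_def sq_radius_def complex_of_real_def mult.commute)

lemma wave_torus_has_derivative: "(wave_torus x m e has_derivative wave_deriv \<theta>) (at \<theta>)"
proof -
  have p: "(phase m has_derivative phase m) (at \<theta>)"
    by (rule bounded_linear_imp_has_derivative[OF phase_linear])
  have t: "((\<lambda>\<theta>. \<theta> $ j) has_derivative (\<lambda>\<xi>. \<xi> $ j)) (at \<theta>)" for j
    by (rule bounded_linear_imp_has_derivative[OF bounded_linear_vec_nth])
  have 1: "((\<lambda>\<theta>. sqrt (sq_radius \<theta> j)) has_derivative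
      (\<lambda>\<xi>. - m j * (e * sin (phase m \<theta>)) * phase m \<xi> / sqrt (sq_radius \<theta> j))) (at \<theta>)" for j
  proof -
    have d: "((\<lambda>\<theta>. sq_radius \<theta> j) has_derivative (\<lambda>\<xi>. - 2 * m j * (e * sin (phase m \<theta>)) * phase m \<xi>)) (at \<theta>)"
      unfolding sq_radius_def
      by (rule derivative_eq_intros p refl | simp add: mult_ac)+
    show ?thesis
      by (rule has_derivative_eq_rhs[OF has_derivative_real_sqrt[where g="\<lambda>\<theta>. sq_radius \<theta> j", OF sq_radius_pos d]])
         (simp add: fun_eq_iff inverse_eq_divide)
  qed
  have 2: "((\<lambda>\<theta>. sqrt (sq_radius \<theta> j) *\<^sub>R cis (\<theta> $ j)) has_derivative
      (\<lambda>\<xi>. cis (\<theta> $ j) * Complex (- m j * (e * sin (phase m \<theta>)) * phase m \<xi> / sqrt (sq_radius \<theta> j))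
        (sqrt (sq_radius \<theta> j) * \<xi> $ j))) (at \<theta>)" for j
    by (rule has_derivative_eq_rhs[OF has_derivative_scaleR[OF 1 has_derivative_cis[OF t]]])
       (simp add: fun_eq_iff complex_eq_iff algebra_simps)
  have "wave_torus x m e = (\<lambda>\<theta>. \<chi> j. sqrt (sq_radius \<theta> j) *\<^sub>R cis (\<theta> $ j))"
    by (simp add: fun_eq_iff wave_torus_def sq_radius_def scaleR_conv_of_real)
  then show ?thesis
    using has_derivative_vec_lambda[OF 2] by (simp add: wave_deriv_def[abs_def])
qed

text \<open>The term with \<open>m i * m l\<close> comes from the radial parts of the tangent
  vectors. The other terms come from the angular parts and give the Gram matrix of a product torus
  with the same radii.\<close>
lemma gram_wave:
  "gram (\<lambda>\<theta>. flat_to_hyp (wave_torus x m e \<theta>)) \<theta> =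
    (\<chi> i l. (if i = l then sq_radius \<theta> i else 0) + sq_radius \<theta> i * sq_radius \<theta> l + (e * sin (phase m \<theta>))\<^sup>2 *
      ((\<Sum>j\<in>UNIV. (m j)\<^sup>2 / sq_radius \<theta> j) - (\<Sum>j\<in>UNIV. m j)\<^sup>2 / (1 + (\<Sum>j\<in>UNIV. sq_radius \<theta> j))) * (m i * m l))"
proof -
  let ?w = "wave_torus x m e \<theta>" and ?s = "e * sin (phase m \<theta>)"
  have d: "frechet_derivative (\<lambda>\<theta>. flat_to_hyp (wave_torus x m e \<theta>)) (at \<theta>) \<xi> =
      flat_to_hyp_deriv ?w (wave_deriv \<theta> \<xi>)" for \<xi>
    using frechet_derivative_at[OF has_derivative_compose[OF wave_torus_has_derivative flat_to_hyp_has_derivative]]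
    by metis
  have ci: "(cis t * u) \<bullet> (cis t * v) = u \<bullet> v" for t u v
  proof -
    have "(cis t * u) \<bullet> (cis t * v) = Re (cis t * cnj (cis t) * (u * cnj v))"
      unfolding inner_complex_def by (simp add: algebra_simps)
    also have "cis t * cnj (cis t) = 1" by (simp add: cis_cnj cis_mult)
    finally show ?thesis by (simp add: inner_complex_def)
  qed
  have cc: "cis t * u * cnj (cis t * v) = u * cnj v" for t u v
  proof -
    have "cis t * u * cnj (cis t * v) = (cis t * cnj (cis t)) * (u * cnj v)" by simp
    also have "cis t * cnj (cis t) = 1" by (simp add: cis_cnj cis_mult)
    finally show ?thesis by simp
  qed
  have sq: "sqrt (sq_radius \<theta> j) * (sqrt (sq_radius \<theta> j) * t) = sq_radius \<theta> j * t" "sqrt (sq_radius \<theta> j) \<noteq> 0" for j t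
    using sq_radius_pos[of \<theta> j] by (simp_all add: mult.assoc[symmetric])
  have ww: "?w \<bullet> ?w = (\<Sum>j\<in>UNIV. sq_radius \<theta> j)"
    unfolding wave_torus_sq_radius inner_vec_def vec_lambda_beta ci using sq(1)[of _ 1] by (simp add: inner_complex_def)
  have wh: "?w \<bullet> wave_deriv \<theta> \<xi> = - ?s * phase m \<xi> * (\<Sum>j\<in>UNIV. m j)" for \<xi>
    unfolding wave_torus_sq_radius wave_deriv_def inner_vec_def vec_lambda_beta ci sum_distrib_left
    using sq(2) by (intro sum.cong) (auto simp: inner_complex_def)
  have ih: "Im (herm (wave_deriv \<theta> \<xi>) ?w) = (\<Sum>j\<in>UNIV. sq_radius \<theta> j * \<xi> $ j)" for \<xi>
    unfolding wave_torus_sq_radius wave_deriv_def herm_def vec_lambda_beta cc Im_sum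
    by (intro sum.cong) (auto simp: mult_ac sq(1) abs_of_pos[OF sq_radius_pos])
  have hk: "wave_deriv \<theta> \<xi> \<bullet> wave_deriv \<theta> \<eta> = ?s\<^sup>2 * (phase m \<xi> * phase m \<eta>) * (\<Sum>j\<in>UNIV. (m j)\<^sup>2 / sq_radius \<theta> j) +
      (\<Sum>j\<in>UNIV. sq_radius \<theta> j * (\<xi> $ j * \<eta> $ j))" for \<xi> \<eta>
    unfolding wave_deriv_def inner_vec_def vec_lambda_beta ci sum_distrib_left sum.distrib[symmetric]
  proof (intro sum.cong refl)
    fix j
    have "sqrt (sq_radius \<theta> j) * sqrt (sq_radius \<theta> j) = sq_radius \<theta> j" using sq_radius_pos[of \<theta> j] by simp
    then show "Complex (- m j * ?s * phase m \<xi> / sqrt (sq_radius \<theta> j)) (sqrt (sq_radius \<theta> j) * \<xi> $ j) \<bullet>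
        Complex (- m j * ?s * phase m \<eta> / sqrt (sq_radius \<theta> j)) (sqrt (sq_radius \<theta> j) * \<eta> $ j) =
        ?s\<^sup>2 * (phase m \<xi> * phase m \<eta>) * ((m j)\<^sup>2 / sq_radius \<theta> j) + sq_radius \<theta> j * (\<xi> $ j * \<eta> $ j)"
      by (simp add: inner_complex_def power2_eq_square mult_ac sq(1))
  qed
  have ax: "(\<Sum>j\<in>UNIV. sq_radius \<theta> j * axis i 1 $ j) = sq_radius \<theta> i" for i
    unfolding axis_def by (simp add: if_distrib[of "\<lambda>t. _ * t"] cong: if_cong)
  have axx: "(\<Sum>j\<in>UNIV. sq_radius \<theta> j * (axis i 1 $ j * axis l 1 $ j)) = (if i = l then sq_radius \<theta> i else 0)" for i l
    unfolding axis_def by (simp add: if_distrib[of "\<lambda>t. _ * t"] if_distrib[of "\<lambda>t. t * _"] cong: if_cong)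
  show ?thesis
    unfolding gram_def d hyp_metric_flat ww wh ih hk ax axx phase_axis
    by (simp add: vec_eq_iff power2_eq_square algebra_simps)
qed

lemma sqrt_det_gram:
  "sqrt (det (gram (\<lambda>\<theta>. flat_to_hyp (wave_torus x m e \<theta>)) \<theta>)) =
     vol_density x m (e * cos (phase m \<theta>)) (e * sin (phase m \<theta>))"
  unfolding gram_wave det_diagonal_plus_rank_two[OF sq_radius_pos] vol_density_def Let_def sq_radius_def[symmetric]
  by (simp add: power2_eq_square mult_ac)

lemma vol_density_nonneg: "vol_density x m (e * cos (phase m \<theta>)) (e * sin (phase m \<theta>)) \<ge> 0"
  unfolding vol_density_def Let_def sq_radius_def[symmetric]
  by (intro real_sqrt_ge_zero mult_nonneg_nonneg add_nonneg_nonneg prod_nonneg sum_nonneg)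
     (auto simp: sq_radius_pos less_imp_le)

lemma C_k_on_wave: "C_k_on k UNIV (wave_torus x m e)"
proof (rule C_k_on_cong)
  show "(\<chi> j. ((x j + 2 * m j * (e * cos (phase m \<theta>))) powr (1 / 2)) *\<^sub>R
      (cos (\<theta> $ j) *\<^sub>R 1 + sin (\<theta> $ j) *\<^sub>R \<i>)) = wave_torus x m e \<theta>" for \<theta>
    using sq_radius_pos[of \<theta>] by (simp add: wave_torus_def vec_eq_iff sq_radius_def powr_half_sqrt less_imp_le complex_eq_iff)
  have "C_k_on k UNIV (phase m)"
    by (rule C_k_on_linear[OF open_UNIV phase_linear C_k_on_id[OF open_UNIV]])
  then show "C_k_on k UNIV (\<lambda>\<theta>. \<chi> j. ((x j + 2 * m j * (e * cos (phase m \<theta>))) powr (1 / 2)) *\<^sub>R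
      (cos (\<theta> $ j) *\<^sub>R 1 + sin (\<theta> $ j) *\<^sub>R (\<i>)))"
    using sq_radius_pos unfolding sq_radius_def
    by (intro C_k_on_vec_lambda C_k_on_scaleR C_k_on_powr C_k_on_add C_k_on_mult C_k_on_const
        C_k_on_cos C_k_on_sin C_k_on_nth C_k_on_id open_UNIV)
qed simp

lemma has_volume_wave:
  "has_volume ((\<lambda>\<theta>. flat_to_hyp (wave_torus x m e \<theta>)) ` angle_box)
    (\<integral>\<^sup>+\<theta>\<in>angle_box. ennreal (vol_density x m (e * cos (phase m \<theta>)) (e * sin (phase m \<theta>))) \<partial>lborel)"
proof -
  let ?\<phi> = "\<lambda>\<theta>. flat_to_hyp (wave_torus x m e \<theta>)"
  have "C_k_on 1 UNIV ?\<phi>"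
    by (rule C_k_on_compose[OF open_UNIV open_UNIV _ C_k_on_flat_to_hyp C_k_on_wave]) simp
  moreover have "?\<phi> ` UNIV \<subseteq> ball 0 1"
    using flat_to_hyp_in_ball by blast
  moreover have "\<forall>\<theta>\<in>UNIV. inj (frechet_derivative ?\<phi> (at \<theta>))"
  proof
    fix \<theta> :: "real ^ 'n"
    have d: "(?\<phi> has_derivative (\<lambda>\<xi>. flat_to_hyp_deriv (wave_torus x m e \<theta>) (wave_deriv \<theta> \<xi>))) (at \<theta>)"
      by (rule has_derivative_compose[OF wave_torus_has_derivative flat_to_hyp_has_derivative])
    interpret bounded_linear "\<lambda>\<xi>. flat_to_hyp_deriv (wave_torus x m e \<theta>) (wave_deriv \<theta> \<xi>)"
      by (rule has_derivative_bounded_linear[OF d])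
    have "\<xi> = 0" if "flat_to_hyp_deriv (wave_torus x m e \<theta>) (wave_deriv \<theta> \<xi>) = 0" for \<xi>
    proof -
      have "kaehler_form (flat_to_hyp (wave_torus x m e \<theta>)) 0 v = 0" for v
        unfolding kaehler_form_eq(2)[OF flat_to_hyp_in_ball] by simp
      then have "flat_form (wave_deriv \<theta> \<xi>) h = 0" for h
        using kaehler_form_flat[of "wave_torus x m e \<theta>" "wave_deriv \<theta> \<xi>" h] unfolding that by simp
      then have "J_std (wave_deriv \<theta> \<xi>) = 0"
        unfolding flat_form_J by (metis inner_eq_zero_iff)
      then have "cis (\<theta> $ j) * Complex (- m j * (e * sin (phase m \<theta>)) * phase m \<xi> / sqrt (sq_radius \<theta> j))
          (sqrt (sq_radius \<theta> j) * \<xi> $ j) = 0" for j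
        by (simp add: J_std_def wave_deriv_def vec_eq_iff)
      then have "Complex (- m j * (e * sin (phase m \<theta>)) * phase m \<xi> / sqrt (sq_radius \<theta> j))
          (sqrt (sq_radius \<theta> j) * \<xi> $ j) = 0" for j
        unfolding mult_eq_0_iff using cis_neq_zero by blast
      then have "sqrt (sq_radius \<theta> j) * \<xi> $ j = 0" for j
        unfolding complex_eq_iff by simp
      then show ?thesis using sq_radius_pos[of \<theta>] by (simp add: vec_eq_iff) (metis less_irrefl)
    qed
    then have "inj (\<lambda>\<xi>. flat_to_hyp_deriv (wave_torus x m e \<theta>) (wave_deriv \<theta> \<xi>))"
      using linear_injective_0[OF linear_axioms] by blast
    then show "inj (frechet_derivative ?\<phi> (at \<theta>))"
      using frechet_derivative_at[OF d] by simp
  qed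
  moreover have "inj_on ?\<phi> angle_box"
  proof (rule inj_onI)
    fix \<theta> \<eta> assume *: "\<theta> \<in> angle_box" "\<eta> \<in> angle_box" "?\<phi> \<theta> = ?\<phi> \<eta>"
    have "wave_torus x m e \<theta> = wave_torus x m e \<eta>"
      using arg_cong[OF *(3), of hyp_to_flat] by (simp add: hyp_to_flat_to_hyp)
    moreover have "Arg2pi (wave_torus x m e \<theta> $ j) = \<theta> $ j" if "\<theta> \<in> angle_box" for \<theta> j
      by (rule Arg2pi_unique[where r="sqrt (sq_radius \<theta> j)"])
        (use that sq_radius_pos[of \<theta> j] in \<open>auto simp: angle_box_def wave_torus_def sq_radius_def cis_conv_exp\<close>)
    ultimately show "\<theta> = \<eta>" using *(1,2) by (simp add: vec_eq_iff) metis
  qed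
  moreover have "angle_box \<in> sets (borel :: (real ^ 'n) measure)"
    unfolding angle_box_def by measurable
  ultimately show ?thesis
    unfolding has_volume_def sqrt_det_gram[symmetric]
    by (intro exI[of _ UNIV] exI[of _ angle_box] exI[of _ ?\<phi>]) simp
qed

end

section \<open>Integrals over the angles and the second variation\<close>

definition quarter_box :: "'n::finite \<Rightarrow> (real ^ 'n) set" where
  "quarter_box k = {\<theta> \<in> angle_box. \<theta> $ k < pi / 2}"

lemma sum_four: "(\<Sum>n<4. f n) = f 0 + f 1 + f 2 + f (3::nat)"
  by (simp add: eval_nat_numeral)

text \<open>The angle box is cut into four translates along the axis \<open>k\<close>.\<close>
lemma quarter_indicators:
  "(indicator angle_box \<theta> :: ennreal) =
     (\<Sum>n<4. indicator (quarter_box k) (\<theta> - axis k (real n * (pi / 2))))"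
proof -
  let ?O = "\<forall>j. j \<noteq> k \<longrightarrow> 0 \<le> \<theta> $ j \<and> \<theta> $ j < 2 * pi"
  have 1: "\<theta> - axis k t \<in> quarter_box k \<longleftrightarrow> ?O \<and> t \<le> \<theta> $ k \<and> \<theta> $ k < t + pi / 2"
    if "t \<le> 3 * (pi / 2)" for t
  proof -
    have c: "(\<theta> - axis k t) $ j = (if j = k then \<theta> $ k - t else \<theta> $ j)" for j
      by (simp add: axis_def)
    have "\<theta> - axis k t \<in> quarter_box k \<longleftrightarrow>
        (\<forall>j. 0 \<le> (\<theta> - axis k t) $ j \<and> (\<theta> - axis k t) $ j < 2 * pi) \<and> (\<theta> - axis k t) $ k < pi / 2"
      by (simp add: quarter_box_def angle_box_def)
    also have "\<dots> \<longleftrightarrow> ?O \<and> 0 \<le> \<theta> $ k - t \<and> \<theta> $ k - t < 2 * pi \<and> \<theta> $ k - t < pi / 2"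
      unfolding c by (auto split: if_splits)
    also have "\<dots> \<longleftrightarrow> ?O \<and> t \<le> \<theta> $ k \<and> \<theta> $ k < t + pi / 2"
      using pi_gt_zero by (smt (verit) field_sum_of_halves)
    finally show ?thesis .
  qed
  have 2: "\<theta> \<in> angle_box \<longleftrightarrow> ?O \<and> 0 \<le> \<theta> $ k \<and> \<theta> $ k < 2 * pi"
    unfolding angle_box_def by auto
  have p: "pi > 0" by simp
  consider "\<not> ?O" | "\<theta> $ k < 0" | "0 \<le> \<theta> $ k" "\<theta> $ k < pi / 2" | "pi / 2 \<le> \<theta> $ k" "\<theta> $ k < pi"
    | "pi \<le> \<theta> $ k" "\<theta> $ k < 3 * pi / 2" | "3 * pi / 2 \<le> \<theta> $ k" "\<theta> $ k < 2 * pi" | "2 * pi \<le> \<theta> $ k"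
    by linarith
  then show ?thesis
    unfolding sum_four indicator_def of_bool_def 2
    by cases (use p in \<open>simp_all add: 1 del: not_all\<close>)
qed

lemma quarter_box_measurable: "quarter_box k \<in> sets borel"
  unfolding quarter_box_def angle_box_def by measurable

lemma nn_integral_angle_box:
  fixes f :: "real ^ 'n::finite \<Rightarrow> ennreal"
  assumes f: "f \<in> borel_measurable borel"
  shows "(\<integral>\<^sup>+\<theta>\<in>angle_box. f \<theta> \<partial>lborel) =
    (\<integral>\<^sup>+\<theta>\<in>quarter_box k. (\<Sum>n<4. f (\<theta> + axis k (real n * (pi / 2)))) \<partial>lborel)"
proof -
  note [measurable] = quarter_box_measurable[of k] f
  define c where "c = (\<lambda>n::nat. axis k (real n * (pi / 2)) :: real ^ 'n)"
  have "(\<integral>\<^sup>+\<theta>\<in>angle_box. f \<theta> \<partial>lborel) =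
      (\<integral>\<^sup>+\<theta>. (\<Sum>n<4. f \<theta> * indicator (quarter_box k) (\<theta> - c n)) \<partial>lborel)"
    by (simp add: quarter_indicators[of _ k] sum_distrib_left c_def)
  also have "\<dots> = (\<Sum>n<4. \<integral>\<^sup>+\<theta>. f \<theta> * indicator (quarter_box k) (\<theta> - c n) \<partial>lborel)"
    by (rule nn_integral_sum) measurable
  also have "\<dots> = (\<Sum>n<4. \<integral>\<^sup>+\<theta>. f (\<theta> + c n) * indicator (quarter_box k) \<theta> \<partial>lborel)"
  proof (rule sum.cong[OF refl])
    fix n
    have "(\<integral>\<^sup>+\<theta>. f \<theta> * indicator (quarter_box k) (\<theta> - c n) \<partial>lborel) =
        (\<integral>\<^sup>+\<theta>. f \<theta> * indicator (quarter_box k) (\<theta> - c n) \<partial>(distr lborel borel ((+) (c n))))"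
      by (simp only: lborel_distr_plus)
    also have "\<dots> = (\<integral>\<^sup>+\<theta>. f (c n + \<theta>) * indicator (quarter_box k) (c n + \<theta> - c n) \<partial>lborel)"
      by (rule nn_integral_distr) measurable
    finally show "(\<integral>\<^sup>+\<theta>. f \<theta> * indicator (quarter_box k) (\<theta> - c n) \<partial>lborel) =
        (\<integral>\<^sup>+\<theta>. f (\<theta> + c n) * indicator (quarter_box k) \<theta> \<partial>lborel)"
      by (simp add: add.commute)
  qed
  also have "\<dots> = (\<integral>\<^sup>+\<theta>. (\<Sum>n<4. f (\<theta> + c n) * indicator (quarter_box k) \<theta>) \<partial>lborel)"
    by (rule nn_integral_sum[symmetric]) measurable
  finally show ?thesis
    by (simp add: sum_distrib_right c_def)
qed

lemma emeasure_quarter_box: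
  "0 < emeasure lborel (quarter_box k)" "emeasure lborel (quarter_box k) < \<infinity>"
proof -
  have "quarter_box k \<subseteq> cbox 0 (\<chi> j. 2 * pi)"
    by (auto simp: quarter_box_def angle_box_def mem_box_cart less_imp_le)
  then have "emeasure lborel (quarter_box k) \<le> emeasure lborel (cbox 0 (\<chi> j. 2 * pi) :: (real ^ 'a) set)"
    by (rule emeasure_mono) simp
  also have "\<dots> < \<infinity>" by (rule emeasure_lborel_cbox_finite)
  finally show "emeasure lborel (quarter_box k) < \<infinity>" .
  have "box 0 (\<chi> j. pi / 2) \<subseteq> quarter_box k"
  proof
    fix \<theta> :: "real ^ 'a" assume "\<theta> \<in> box 0 (\<chi> j. pi / 2)"
    then have *: "0 < \<theta> $ j" "\<theta> $ j < pi / 2" for j by (simp_all add: mem_box_cart)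
    have "0 \<le> \<theta> $ j" "\<theta> $ j < 2 * pi" for j
      using *[of j] pi_gt_zero by linarith+
    then show "\<theta> \<in> quarter_box k" using * by (simp add: quarter_box_def angle_box_def)
  qed
  moreover have "(\<chi> j. pi / 4) \<in> (box 0 (\<chi> j. pi / 2) :: (real ^ 'a) set)"
    by (simp add: mem_box_cart)
  then have "emeasure lborel (box 0 (\<chi> j. pi / 2) :: (real ^ 'a) set) \<noteq> 0"
    using open_not_negligible[OF open_box] by (auto simp: negligible_iff_emeasure0)
  ultimately show "0 < emeasure lborel (quarter_box k)"
    using emeasure_mono[of "box 0 (\<chi> j. pi / 2)" "quarter_box k" lborel] quarter_box_measurable[of k]
    by (auto simp: zero_less_iff_neq_zero)
qed

text \<open>In the sum over four quarter turns of one angle, the terms of first order in the size of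
  a perturbation cancel pointwise. With this criterion no integral of a trigonometric function has
  to be computed.\<close>
lemma nn_integral_angle_box_less:
  fixes f :: "real ^ 'n::finite \<Rightarrow> real"
  assumes f: "f \<in> borel_measurable borel" "\<And>\<theta>. f \<theta> \<ge> 0"
    and d: "\<And>\<theta>. (\<Sum>n<4. f (\<theta> + axis k (real n * (pi / 2)))) \<le> d" "d < 4 * c"
  shows "(\<integral>\<^sup>+\<theta>\<in>angle_box. ennreal (f \<theta>) \<partial>lborel) < (\<integral>\<^sup>+\<theta>\<in>(angle_box :: (real ^ 'n) set). ennreal c \<partial>lborel)"
proof -
  note [measurable] = quarter_box_measurable[of k] f(1)
  have d0: "d \<ge> 0"
    using order_trans[OF sum_nonneg d(1)] f(2) by blast
  have "(\<integral>\<^sup>+\<theta>\<in>angle_box. ennreal (f \<theta>) \<partial>lborel) =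
      (\<integral>\<^sup>+\<theta>\<in>quarter_box k. (\<Sum>n<4. ennreal (f (\<theta> + axis k (real n * (pi / 2))))) \<partial>lborel)"
    by (rule nn_integral_angle_box) measurable
  also have "\<dots> \<le> (\<integral>\<^sup>+\<theta>\<in>quarter_box k. ennreal d \<partial>lborel)"
    using f(2) d(1) by (intro nn_integral_mono mult_right_mono) (simp_all add: sum_ennreal ennreal_leI)
  also have "\<dots> = ennreal d * emeasure lborel (quarter_box k)"
    by (rule nn_integral_cmult_indicator) simp
  also have "\<dots> < ennreal (4 * c) * emeasure lborel (quarter_box k)"
    using emeasure_quarter_box[of k] d(2) d0
    by (intro ennreal_mult_strict_right_mono) (auto simp: ennreal_lessI)
  also have "\<dots> = (\<integral>\<^sup>+\<theta>\<in>quarter_box k. ennreal (4 * c) \<partial>lborel)"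
    by (rule nn_integral_cmult_indicator[symmetric]) simp
  also have "\<dots> = (\<integral>\<^sup>+\<theta>\<in>quarter_box k. (\<Sum>n<4::nat. ennreal c) \<partial>lborel)"
    using d0 d(2) by (simp add: ennreal_mult)
  also have "\<dots> = (\<integral>\<^sup>+\<theta>\<in>(angle_box :: (real ^ 'n) set). ennreal c \<partial>lborel)"
    by (rule nn_integral_angle_box[of "\<lambda>_. ennreal c" k, symmetric]) simp
  finally show ?thesis .
qed

text \<open>Here \<open>p\<close> and \<open>q\<close> are the normalized product and the number
  \<open>Q\<close> from \<open>vol_density\<close>, as functions of \<open>a = e cos \<psi>\<close>.
  The Taylor polynomial of \<open>p\<close> of order two is \<open>1 + 2 s a + 4 e2
  a\<^sup>2\<close>, where \<open>e2\<close> is the second elementary symmetric polynomial of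
  \<open>A, -B, -C, -E\<close>. Hence the square root is, to second order, \<open>1 + s a + ((4 e2 -
  s\<^sup>2) a\<^sup>2 + (q 0)\<^sup>2 b\<^sup>2) / 2\<close>, and \<open>4 e2 - s\<^sup>2 + (q
  0)\<^sup>2 = 4 (B C - A E)\<close>. A fraction of this negative number is spent on the remainders,
  which are then dominated by continuity at \<open>a = 0\<close>.\<close>
lemma second_variation_bound:
  fixes A B C E :: real
  defines "p \<equiv> \<lambda>a. (1 + 2 * A * a) * (1 - 2 * B * a) * (1 - 2 * C * a) * (1 - 2 * E * a)"
    and "q \<equiv> \<lambda>a. A / (1 + 2 * A * a) + B / (1 - 2 * B * a) + C / (1 - 2 * C * a) - E / (1 - 2 * E * a)"
    and "s \<equiv> A - B - C - E"
  assumes BC: "B * C < A * E"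
  obtains \<delta> \<alpha> \<beta> where "\<delta> > 0" "\<alpha> + \<beta> < 0"
    "\<And>a b. \<bar>a\<bar> < \<delta> \<Longrightarrow> sqrt (p a * (1 + b\<^sup>2 * (q a)\<^sup>2)) \<le> 1 + s * a + (\<alpha> * a\<^sup>2 + \<beta> * b\<^sup>2) / 2"
proof -
  have id0: "((\<lambda>a. a) \<longlongrightarrow> 0) (nhds (0::real))" by (rule filterlim_ident)
  define \<eta> where "\<eta> = A * E - B * C"
  define e2 where "e2 = - A * B - A * C - A * E + B * C + B * E + C * E"
  define e3 where "e3 = A * B * C + A * B * E + A * C * E - B * C * E"
  define e4 where "e4 = - A * B * C * E"
  define \<alpha> where "\<alpha> = 4 * e2 - s\<^sup>2 + \<eta>"
  define \<beta> where "\<beta> = (A + B + C - E)\<^sup>2 + \<eta>"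
  have \<eta>: "\<eta> > 0" using BC by (simp add: \<eta>_def)
  have "\<alpha> + \<beta> = - 2 * \<eta>"
    by (simp add: \<alpha>_def \<beta>_def e2_def s_def \<eta>_def power2_eq_square algebra_simps)
  then have neg: "\<alpha> + \<beta> < 0" using \<eta> by simp
  have pe: "p a = 1 + 2 * s * a + (4 * e2 + 8 * e3 * a + 16 * e4 * a\<^sup>2) * a\<^sup>2" for a
    by (simp add: p_def s_def e2_def e3_def e4_def power2_eq_square algebra_simps)
  have "((\<lambda>a. s\<^sup>2 + (1 + s * a) * \<alpha> - (4 * e2 + 8 * e3 * a + 16 * e4 * a\<^sup>2)) \<longlongrightarrow>
      s\<^sup>2 + (1 + s * 0) * \<alpha> - (4 * e2 + 8 * e3 * 0 + 16 * e4 * 0\<^sup>2)) (nhds 0)"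
    by (intro tendsto_intros id0)
  then have ev1: "\<forall>\<^sub>F a in nhds 0. s\<^sup>2 + (1 + s * a) * \<alpha> - (4 * e2 + 8 * e3 * a + 16 * e4 * a\<^sup>2) > 0"
    by (rule order_tendstoD) (simp add: \<alpha>_def \<eta>)
  have "((\<lambda>a. (1 + s * a) * \<beta> - p a * (q a)\<^sup>2) \<longlongrightarrow> (1 + s * 0) * \<beta> - p 0 * (q 0)\<^sup>2) (nhds 0)"
    unfolding p_def q_def by (intro tendsto_intros id0) simp_all
  then have ev2: "\<forall>\<^sub>F a in nhds 0. (1 + s * a) * \<beta> - p a * (q a)\<^sup>2 > 0"
    by (rule order_tendstoD) (simp add: \<beta>_def p_def q_def \<eta>)
  have "((\<lambda>a. 1 + s * a) \<longlongrightarrow> 1 + s * 0) (nhds 0)"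
    by (intro tendsto_intros id0)
  then have ev3: "\<forall>\<^sub>F a in nhds 0. 1 + s * a > 0"
    by (rule order_tendstoD) simp
  have "(p \<longlongrightarrow> p 0) (nhds 0)"
    unfolding p_def by (intro tendsto_intros id0)
  then have ev4: "\<forall>\<^sub>F a in nhds 0. p a > 0"
    by (rule order_tendstoD) (simp add: p_def)
  obtain \<delta> where \<delta>: "\<delta> > 0" "\<And>a. \<bar>a\<bar> < \<delta> \<Longrightarrow>
      s\<^sup>2 + (1 + s * a) * \<alpha> - (4 * e2 + 8 * e3 * a + 16 * e4 * a\<^sup>2) > 0 \<and>
      (1 + s * a) * \<beta> - p a * (q a)\<^sup>2 > 0 \<and> 1 + s * a > 0 \<and> p a > 0"
    using eventually_conj[OF ev1 eventually_conj[OF ev2 eventually_conj[OF ev3 ev4]]]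
    unfolding eventually_nhds_metric by (auto simp: dist_real_def)
  show thesis
  proof (rule that[OF \<delta>(1) neg])
    fix a b :: real assume a: "\<bar>a\<bar> < \<delta>"
    define l where "l = 1 + s * a"
    have l: "l > 0" using \<delta>(2)[OF a] by (simp add: l_def)
    have "(4 * e2 + 8 * e3 * a + 16 * e4 * a\<^sup>2) * a\<^sup>2 \<le> (s\<^sup>2 + l * \<alpha>) * a\<^sup>2"
      using \<delta>(2)[OF a] by (intro mult_right_mono) (auto simp: l_def)
    moreover have "l\<^sup>2 = 1 + 2 * s * a + s\<^sup>2 * a\<^sup>2"
      by (simp add: l_def power2_eq_square algebra_simps)
    ultimately have 1: "p a \<le> l\<^sup>2 + l * (\<alpha> * a\<^sup>2)"
      unfolding pe by (simp add: algebra_simps)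
    have "p a * (q a)\<^sup>2 * b\<^sup>2 \<le> l * \<beta> * b\<^sup>2"
      using \<delta>(2)[OF a] by (intro mult_right_mono) (auto simp: l_def)
    with 1 have y: "p a * (1 + b\<^sup>2 * (q a)\<^sup>2) \<le> l\<^sup>2 + l * (\<alpha> * a\<^sup>2 + \<beta> * b\<^sup>2)"
      by (simp add: algebra_simps)
    \<comment> \<open>By completing the square, the root of \<open>l\<^sup>2 + l t\<close> is at most \<open>l + t / 2\<close>.\<close>
    define t where "t = \<alpha> * a\<^sup>2 + \<beta> * b\<^sup>2"
    have "0 \<le> p a * (1 + b\<^sup>2 * (q a)\<^sup>2)"
      using \<delta>(2)[OF a] by (intro mult_nonneg_nonneg) auto
    then have "0 \<le> l * (l + t)"
      using y by (simp add: t_def power2_eq_square distrib_left)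
    then have "l + t / 2 \<ge> 0"
      using l by (simp add: zero_le_mult_iff)
    moreover have "p a * (1 + b\<^sup>2 * (q a)\<^sup>2) \<le> (l + t / 2)\<^sup>2"
    proof -
      have "l\<^sup>2 + l * t \<le> (l + t / 2)\<^sup>2"
        by (simp add: power2_eq_square algebra_simps)
      then show ?thesis using y unfolding t_def by (rule order_trans[rotated])
    qed
    ultimately have "sqrt (p a * (1 + b\<^sup>2 * (q a)\<^sup>2)) \<le> l + t / 2"
      by (intro real_le_lsqrt) auto
    then show "sqrt (p a * (1 + b\<^sup>2 * (q a)\<^sup>2)) \<le> 1 + s * a + (\<alpha> * a\<^sup>2 + \<beta> * b\<^sup>2) / 2"
      by (simp add: l_def t_def)
  qed
qed

section \<open>Tori and their perturbations\<close>

lemma hyp_torus_eq: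
  assumes "\<And>i. r i > 0"
  shows "hyp_torus r = flat_to_hyp ` torus r"
proof
  show "hyp_torus r \<subseteq> flat_to_hyp ` torus r"
    unfolding hyp_torus_def using flat_to_hyp_to_flat by (metis (mono_tags, lifting) image_eqI mem_Collect_eq subsetI)
  show "flat_to_hyp ` torus r \<subseteq> hyp_torus r"
    unfolding hyp_torus_def using flat_to_hyp_in_ball by (auto simp: hyp_to_flat_to_hyp)
qed

lemma torus_eq:
  fixes r :: "'n::finite \<Rightarrow> real"
  assumes r: "\<And>i. r i > 0"
  shows "torus r = wave_torus (\<lambda>i. (r i)\<^sup>2) m 0 ` angle_box"
proof
  have w: "wave_torus (\<lambda>i. (r i)\<^sup>2) m 0 \<theta> = (\<chi> i. of_real (r i) * cis (\<theta> $ i))" for \<theta>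
    using r by (simp add: wave_torus_def less_imp_le)
  show "wave_torus (\<lambda>i. (r i)\<^sup>2) m 0 ` angle_box \<subseteq> torus r"
    unfolding w torus_def by (auto intro!: exI[of _ "\<lambda>i. _ $ i"])
  show "torus r \<subseteq> wave_torus (\<lambda>i. (r i)\<^sup>2) m 0 ` angle_box"
  proof
    fix z assume "z \<in> torus r"
    then obtain \<theta> where z: "z = (\<chi> i. complex_of_real (r i) * cis (\<theta> i))"
      by (auto simp: torus_def)
    define \<eta> where "\<eta> = (\<chi> i. Arg2pi (cis (\<theta> i)))"
    have "cis (\<eta> $ i) = cis (\<theta> i)" for i
      using Arg2pi_eq[of "cis (\<theta> i)"] by (simp add: \<eta>_def cis_conv_exp)
    then have "z = wave_torus (\<lambda>i. (r i)\<^sup>2) m 0 \<eta>"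
      by (simp add: z w)
    moreover have "\<eta> \<in> angle_box"
      using Arg2pi_ge_0 Arg2pi_lt_2pi by (simp add: angle_box_def \<eta>_def)
    ultimately show "z \<in> wave_torus (\<lambda>i. (r i)\<^sup>2) m 0 ` angle_box" by blast
  qed
qed

lemma has_volume_hyp_torus:
  fixes r :: "'n::finite \<Rightarrow> real"
  assumes r: "\<And>i. r i > 0"
  shows "has_volume (hyp_torus r)
    (\<integral>\<^sup>+\<theta>\<in>(angle_box :: (real ^ 'n) set).
       ennreal (sqrt ((\<Prod>i\<in>UNIV. (r i)\<^sup>2) * (1 + (\<Sum>i\<in>UNIV. (r i)\<^sup>2)))) \<partial>lborel)"
proof -
  interpret wave "\<lambda>i. (r i)\<^sup>2" "\<lambda>_. 0" 0
    using zero_less_power[OF r, of _ 2] by unfold_locales simp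
  show ?thesis
    using has_volume_wave
    unfolding hyp_torus_eq[OF r] torus_eq[OF r, where m = "\<lambda>_. 0"] image_image
    by (simp add: vol_density_def Let_def)
qed

lemma compact_polyannulus:
  fixes lo hi :: "'n::finite \<Rightarrow> real"
  shows "compact {z :: complex ^ 'n. \<forall>l. lo l \<le> norm (z $ l) \<and> norm (z $ l) \<le> hi l}"
proof (rule compact_eq_bounded_closed[THEN iffD2], intro conjI)
  show "closed {z :: complex ^ 'n. \<forall>l. lo l \<le> norm (z $ l) \<and> norm (z $ l) \<le> hi l}"
    by (intro closed_Collect_all closed_Collect_conj closed_Collect_le continuous_intros)
  show "bounded {z :: complex ^ 'n. \<forall>l. lo l \<le> norm (z $ l) \<and> norm (z $ l) \<le> hi l}"
  proof (rule boundedI)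
    fix z :: "complex ^ 'n" assume z: "z \<in> {z. \<forall>l. lo l \<le> norm (z $ l) \<and> norm (z $ l) \<le> hi l}"
    have "norm z \<le> (\<Sum>l\<in>UNIV. norm (z $ l))"
      unfolding norm_vec_def by (rule L2_set_le_sum) simp
    also have "\<dots> \<le> (\<Sum>l\<in>UNIV. hi l)"
      using z by (intro sum_mono) simp
    finally show "norm z \<le> (\<Sum>l\<in>UNIV. hi l)" .
  qed
qed

text \<open>The real factor \<open>Im (cnj (sgn c) * h) / norm c\<close> is the differential of the
  argument of \<open>c\<close>.\<close>
lemma sgn_has_derivative:
  fixes c :: complex
  assumes "c \<noteq> 0"
  shows "(sgn has_derivative (\<lambda>h. (Im (cnj (sgn c) * h) / norm c) *\<^sub>R (\<i> * sgn c))) (at c)"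
proof -
  have n: "(norm has_derivative (\<lambda>h. h \<bullet> sgn c)) (at c)"
    by (rule has_derivative_norm[OF assms])
  have "((\<lambda>c. inverse (norm c) *\<^sub>R c) has_derivative
      (\<lambda>h. inverse (norm c) *\<^sub>R h + (- (inverse (norm c) * (h \<bullet> sgn c) * inverse (norm c))) *\<^sub>R c)) (at c)"
    by (rule has_derivative_scaleR[OF Deriv.has_derivative_inverse[where f=norm, OF _ n] has_derivative_ident])
       (use assms in simp)
  moreover have "inverse (norm c) *\<^sub>R h + (- (inverse (norm c) * (h \<bullet> sgn c) * inverse (norm c))) *\<^sub>R c =
      (Im (cnj (sgn c) * h) / norm c) *\<^sub>R (\<i> * sgn c)" for h
  proof -
    define s where "s = sgn c"
    have c: "c = norm c *\<^sub>R s" using assms by (simp add: s_def sgn_div_norm)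
    have "cmod s = 1" using assms by (simp add: s_def norm_sgn)
    then have s1: "s * cnj s = 1" by (simp add: complex_norm_square[symmetric])
    have "h = s * (cnj s * h)" using s1 by (simp add: mult.assoc[symmetric])
    also have "cnj s * h = of_real (h \<bullet> s) + \<i> * of_real (Im (cnj s * h))"
      by (simp add: complex_eq_iff inner_complex_def algebra_simps)
    finally have h: "h - (h \<bullet> s) *\<^sub>R s = Im (cnj s * h) *\<^sub>R (\<i> * s)"
      by (simp add: scaleR_conv_of_real algebra_simps)
    have "inverse (norm c) *\<^sub>R h + (- (inverse (norm c) * (h \<bullet> s) * inverse (norm c))) *\<^sub>R c =
        inverse (norm c) *\<^sub>R h + (- (inverse (norm c) * (h \<bullet> s) * inverse (norm c))) *\<^sub>R (norm c *\<^sub>R s)"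
      by (subst (2) c) simp
    also have "\<dots> = inverse (norm c) *\<^sub>R (h - (h \<bullet> s) *\<^sub>R s)"
      using assms by (simp add: scaleR_diff_right)
    finally show ?thesis unfolding h by (simp add: s_def divide_inverse mult.commute)
  qed
  ultimately show ?thesis
    by (simp add: sgn_div_norm[abs_def] fun_eq_iff)
qed

lemma C_k_on_sgn:
  fixes f :: "'a::euclidean_space \<Rightarrow> complex"
  assumes "open U" "\<And>x. x \<in> U \<Longrightarrow> f x \<noteq> 0" "C_k_on k U f"
  shows "C_k_on k U (\<lambda>x. sgn (f x))"
proof (rule C_k_on_cong[OF assms(1)])
  show "C_k_on k U (\<lambda>x. ((f x \<bullet> f x) powr (- 1 / 2)) *\<^sub>R f x)"
    by (intro C_k_on_scaleR C_k_on_powr C_k_on_inner assms) (simp add: assms(2))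
  show "((f x \<bullet> f x) powr (- 1 / 2)) *\<^sub>R f x = sgn (f x)" if "x \<in> U" for x
    using assms(2)[OF that] inv_sqrt_powr[of "f x \<bullet> f x"]
    by (simp add: sgn_div_norm norm_eq_sqrt_inner inverse_eq_divide)
qed

lemma flat_form_sum: "flat_form v h = (\<Sum>l\<in>UNIV. Im (cnj (v $ l) * h $ l))"
  by (simp add: flat_form_def herm_def sum_negf[symmetric] algebra_simps)

lemma sum_three:
  fixes f :: "'n::finite \<Rightarrow> 'a::comm_monoid_add"
  assumes "i \<noteq> j" "j \<noteq> k" "i \<noteq> k" "\<And>l. l \<noteq> i \<Longrightarrow> l \<noteq> j \<Longrightarrow> l \<noteq> k \<Longrightarrow> f l = 0"
  shows "(\<Sum>l\<in>UNIV. f l) = f i + f j + f k"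
proof -
  have "(\<Sum>l\<in>UNIV. f l) = (\<Sum>l\<in>{i, j, k}. f l)"
    by (rule sum.mono_neutral_right) (use assms(4) in auto)
  then show ?thesis using assms(1-3) by (simp add: add.assoc)
qed

lemma prod_three:
  fixes f :: "'n::finite \<Rightarrow> 'a::comm_monoid_mult"
  assumes "i \<noteq> j" "j \<noteq> k" "i \<noteq> k" "\<And>l. l \<noteq> i \<Longrightarrow> l \<noteq> j \<Longrightarrow> l \<noteq> k \<Longrightarrow> f l = 1"
  shows "(\<Prod>l\<in>UNIV. f l) = f i * f j * f k"
proof -
  have "(\<Prod>l\<in>UNIV. f l) = (\<Prod>l\<in>{i, j, k}. f l)"
    by (rule prod.mono_neutral_right) (use assms(4) in auto)
  then show ?thesis using assms(1-3) by (simp add: mult.assoc)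
qed

lemma has_vector_derivative_vec_lambda:
  fixes f :: "'n::finite \<Rightarrow> real \<Rightarrow> 'b::euclidean_space"
  assumes "\<And>i. (f i has_vector_derivative f' i) (at t within S)"
  shows "((\<lambda>t. \<chi> i. f i t) has_vector_derivative (\<chi> i. f' i)) (at t within S)"
  using has_derivative_vec_lambda[OF assms[unfolded has_vector_derivative_def]]
  unfolding has_vector_derivative_def
  by (rule has_derivative_eq_rhs) (simp add: fun_eq_iff vec_eq_iff)

text \<open>The coefficients of the angle \<open>\<theta>\<^sub>i - \<theta>\<^sub>j -
  \<theta>\<^sub>k\<close>.\<close>
definition resonance :: "'n \<Rightarrow> 'n \<Rightarrow> 'n \<Rightarrow> 'n::finite \<Rightarrow> real" where
  "resonance i j k l = (if l = i then 1 else if l = j \<or> l = k then - 1 else 0)"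

lemma vol_density_resonance:
  fixes x :: "'n::finite \<Rightarrow> real"
  assumes d: "i \<noteq> j" "j \<noteq> k" "i \<noteq> k" and x: "\<And>l. x l > 0"
  defines "A \<equiv> 1 / x i" and "B \<equiv> 1 / x j" and "C \<equiv> 1 / x k" and "E \<equiv> 1 / (1 + (\<Sum>l\<in>UNIV. x l))"
  shows "vol_density x (resonance i j k) a b =
    sqrt ((\<Prod>l\<in>UNIV. x l) * (1 + (\<Sum>l\<in>UNIV. x l))) *
    sqrt ((1 + 2 * A * a) * (1 - 2 * B * a) * (1 - 2 * C * a) * (1 - 2 * E * a) *
      (1 + b\<^sup>2 * (A / (1 + 2 * A * a) + B / (1 - 2 * B * a) + C / (1 - 2 * C * a) - E / (1 - 2 * E * a))\<^sup>2))"
proof -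
  let ?m = "resonance i j k" and ?S = "1 + (\<Sum>l\<in>UNIV. x l)"
  have x0: "x l \<noteq> 0" for l using x[of l] by simp
  have S: "?S > 0" using x by (intro add_pos_nonneg sum_nonneg) (auto intro: less_imp_le)
  have sm: "(\<Sum>l\<in>UNIV. ?m l) = - 1"
    by (subst sum_three[OF d]) (use d in \<open>auto simp: resonance_def\<close>)
  have sX: "1 + (\<Sum>l\<in>UNIV. x l + 2 * ?m l * a) = ?S * (1 - 2 * E * a)"
  proof -
    have "(\<Sum>l\<in>UNIV. x l + 2 * ?m l * a) = (\<Sum>l\<in>UNIV. x l) + 2 * (\<Sum>l\<in>UNIV. ?m l) * a"
      by (simp add: sum.distrib sum_distrib_left sum_distrib_right)
    then show ?thesis using S by (simp add: sm E_def right_diff_distrib)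
  qed
  have "(\<Prod>l\<in>UNIV. x l + 2 * ?m l * a) = (\<Prod>l\<in>UNIV. x l) * (\<Prod>l\<in>UNIV. 1 + 2 * ?m l * a / x l)"
    unfolding prod.distrib[symmetric] using x0 by (intro prod.cong) (auto simp: distrib_left)
  also have "(\<Prod>l\<in>UNIV. 1 + 2 * ?m l * a / x l) = (1 + 2 * A * a) * (1 - 2 * B * a) * (1 - 2 * C * a)"
    by (subst prod_three[OF d]) (use d in \<open>auto simp: resonance_def A_def B_def C_def\<close>)
  finally have pX: "(\<Prod>l\<in>UNIV. x l + 2 * ?m l * a) =
      (\<Prod>l\<in>UNIV. x l) * ((1 + 2 * A * a) * (1 - 2 * B * a) * (1 - 2 * C * a))" .
  have sQ: "(\<Sum>l\<in>UNIV. (?m l)\<^sup>2 / (x l + 2 * ?m l * a)) = A / (1 + 2 * A * a) + B / (1 - 2 * B * a) + C / (1 - 2 * C * a)"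
    by (subst sum_three[OF d])
      (use d x0 in \<open>auto simp: resonance_def A_def B_def C_def distrib_left right_diff_distrib\<close>)
  have E: "(- 1)\<^sup>2 / (?S * (1 - 2 * E * a)) = E / (1 - 2 * E * a)"
    by (simp add: E_def)
  show ?thesis
    unfolding vol_density_def Let_def sX pX sQ sm E real_sqrt_mult[symmetric]
    by (simp only: mult_ac)
qed

text \<open>The four points \<open>(a, b)\<close> arise from each other by quarter turns: the linear
  terms cancel, and \<open>a\<^sup>2\<close> and \<open>b\<^sup>2\<close> are each replaced by
  \<open>2 e\<^sup>2\<close> in the sum.\<close>
lemma vol_density_rotation_sum:
  fixes x :: "'n::finite \<Rightarrow> real"
  assumes d: "i \<noteq> j" "j \<noteq> k" "i \<noteq> k" and x: "\<And>l. x l > 0"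
    and unstable: "(1 + (\<Sum>l\<in>UNIV. x l)) * x i < x j * x k" and "\<mu> > 0"
  obtains e D where "0 < e" "e < \<mu>"
    "D < 4 * sqrt ((\<Prod>l\<in>UNIV. x l) * (1 + (\<Sum>l\<in>UNIV. x l)))"
    "\<And>\<psi>. (\<Sum>n<4. vol_density x (resonance i j k)
        (e * cos (\<psi> + real n * (pi / 2))) (e * sin (\<psi> + real n * (pi / 2)))) \<le> D"
proof -
  define V where "V = sqrt ((\<Prod>l\<in>UNIV. x l) * (1 + (\<Sum>l\<in>UNIV. x l)))"
  have S: "1 + (\<Sum>l\<in>UNIV. x l) > 0" using x by (intro add_pos_nonneg sum_nonneg) (auto intro: less_imp_le)
  have V: "V > 0" unfolding V_def using S x by (simp add: prod_pos)
  have "1 / x j * (1 / x k) < 1 / x i * (1 / (1 + (\<Sum>l\<in>UNIV. x l)))"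
  proof -
    have "1 / (x j * x k) < 1 / ((1 + (\<Sum>l\<in>UNIV. x l)) * x i)"
      using S x[of i] x[of j] x[of k] by (intro divide_strict_left_mono[OF unstable]) auto
    then show ?thesis by (simp add: mult.commute)
  qed
  from second_variation_bound[OF this] obtain \<delta> \<alpha> \<beta> where \<delta>: "\<delta> > 0" "\<alpha> + \<beta> < 0" and
    bound: "\<And>a b. \<bar>a\<bar> < \<delta> \<Longrightarrow> vol_density x (resonance i j k) a b \<le>
      V * (1 + (1 / x i - 1 / x j - 1 / x k - 1 / (1 + (\<Sum>l\<in>UNIV. x l))) * a + (\<alpha> * a\<^sup>2 + \<beta> * b\<^sup>2) / 2)"
    unfolding vol_density_resonance[OF d x] V_def[symmetric] using V mult_left_mono[of _ _ V]
    by (metis less_imp_le)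
  define s where "s = 1 / x i - 1 / x j - 1 / x k - 1 / (1 + (\<Sum>l\<in>UNIV. x l))"
  define e where "e = min \<delta> \<mu> / 2"
  have e: "0 < e" "e < \<mu>" "e < \<delta>" using \<delta>(1) \<open>\<mu> > 0\<close> by (auto simp: e_def)
  show thesis
  proof (rule that[OF e(1,2), of "V * (4 + e\<^sup>2 * (\<alpha> + \<beta>))"])
    have "V * (4 + e\<^sup>2 * (\<alpha> + \<beta>)) < V * 4"
      using V e(1) \<delta>(2) by (intro mult_strict_left_mono) (auto simp: mult_pos_neg)
    then show "V * (4 + e\<^sup>2 * (\<alpha> + \<beta>)) < 4 * sqrt ((\<Prod>l\<in>UNIV. x l) * (1 + (\<Sum>l\<in>UNIV. x l)))"
      by (simp add: V_def mult.commute)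
    fix \<psi> :: real
    define c where "c = e * cos \<psi>"
    define t where "t = e * sin \<psi>"
    have ct: "c\<^sup>2 + t\<^sup>2 = e\<^sup>2"
      unfolding c_def t_def power_mult_distrib distrib_left[symmetric] by simp
    have small: "\<bar>c\<bar> < \<delta>" "\<bar>t\<bar> < \<delta>" "\<bar>- c\<bar> < \<delta>" "\<bar>- t\<bar> < \<delta>"
    proof -
      have "\<bar>c\<bar> \<le> e" "\<bar>t\<bar> \<le> e" using e(1) by (auto simp: c_def t_def abs_mult mult_left_le)
      then show "\<bar>c\<bar> < \<delta>" "\<bar>t\<bar> < \<delta>" "\<bar>- c\<bar> < \<delta>" "\<bar>- t\<bar> < \<delta>" using e(3) by auto
    qed
    have t3: "cos (\<psi> + 3 * pi / 2) = sin \<psi>" "sin (\<psi> + 3 * pi / 2) = - cos \<psi>"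
      using cos_3over2_pi sin_3over2_pi by (simp_all add: cos_add sin_add)
    have rot: "e * cos (\<psi> + pi / 2) = - t" "e * sin (\<psi> + pi / 2) = c"
      "e * cos (\<psi> + pi) = - c" "e * sin (\<psi> + pi) = - t"
      "e * cos (\<psi> + 3 * pi / 2) = t" "e * sin (\<psi> + 3 * pi / 2) = - c"
      unfolding t3 c_def t_def by (simp_all add: cos_add sin_add)
    have quarter_turns: "real 0 * (pi / 2) = 0" "real 1 * (pi / 2) = pi / 2" "real 2 * (pi / 2) = pi"
      "real 3 * (pi / 2) = 3 * pi / 2"
      by simp_all
    have "(\<Sum>n<4. vol_density x (resonance i j k)
        (e * cos (\<psi> + real n * (pi / 2))) (e * sin (\<psi> + real n * (pi / 2)))) =
      vol_density x (resonance i j k) c t + vol_density x (resonance i j k) (- t) c +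
      vol_density x (resonance i j k) (- c) (- t) + vol_density x (resonance i j k) t (- c)"
      by (simp only: sum_four quarter_turns add_0_right rot c_def[symmetric] t_def[symmetric])
    also have "\<dots> \<le> V * (1 + s * c + (\<alpha> * c\<^sup>2 + \<beta> * t\<^sup>2) / 2) + V * (1 + s * (- t) + (\<alpha> * (- t)\<^sup>2 + \<beta> * c\<^sup>2) / 2) +
        V * (1 + s * (- c) + (\<alpha> * (- c)\<^sup>2 + \<beta> * (- t)\<^sup>2) / 2) + V * (1 + s * t + (\<alpha> * t\<^sup>2 + \<beta> * (- c)\<^sup>2) / 2)"
      unfolding s_def by (intro add_mono bound small)
    also have "\<dots> = V * (4 + (c\<^sup>2 + t\<^sup>2) * (\<alpha> + \<beta>))"
      by (simp add: algebra_simps)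
    finally show "(\<Sum>n<4. vol_density x (resonance i j k)
        (e * cos (\<psi> + real n * (pi / 2))) (e * sin (\<psi> + real n * (pi / 2)))) \<le> V * (4 + e\<^sup>2 * (\<alpha> + \<beta>))"
      unfolding ct .
  qed
qed

lemma not_minimizingI:
  assumes "\<Psi> \<in> Ham_c" "has_volume L V" "has_volume (\<Psi> ` L) V'" "V' < V"
  shows "\<not> hamiltonian_volume_minimizing L"
proof
  assume "hamiltonian_volume_minimizing L"
  then have "V' \<ge> V"
    unfolding hamiltonian_volume_minimizing_def using assms(1-3) by blast
  then show False using assms(4) by simp
qed

section \<open>Instability of tori violating the inequality\<close>

text \<open>The Hamiltonian \<open>G = e sin \<psi>\<close> preserves all angles and changes the
  actions linearly in time, so that the curves \<open>y\<close> are explicit and stay in the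
  polyannulus \<open>K\<close> for small \<open>e\<close>.\<close>
lemma not_minimizing_of_unstable:
  fixes r :: "'n::finite \<Rightarrow> real"
  assumes d: "i \<noteq> j" "j \<noteq> k" "i \<noteq> k" and r: "\<And>l. r l > 0"
    and unstable: "sqrt (1 + (\<Sum>l\<in>UNIV. (r l)\<^sup>2)) * r i < r j * r k"
  shows "\<not> hamiltonian_volume_minimizing (hyp_torus r)"
proof -
  define x where "x = (\<lambda>l. (r l)\<^sup>2)"
  let ?m = "resonance i j k"
  have x: "x l > 0" for l using r[of l] by (simp add: x_def)
  have S: "1 + (\<Sum>l\<in>UNIV. x l) > 0" using x by (intro add_pos_nonneg sum_nonneg) (auto intro: less_imp_le)
  have "(sqrt (1 + (\<Sum>l\<in>UNIV. x l)) * r i)\<^sup>2 < (r j * r k)\<^sup>2"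
    using unstable S r[of i] unfolding x_def by (intro power_strict_mono) (auto simp: less_imp_le)
  then have uns: "(1 + (\<Sum>l\<in>UNIV. x l)) * x i < x j * x k"
    using S by (simp add: power_mult_distrib x_def)
  \<comment> \<open>For \<open>4 e < x l\<close> the squared radii stay between \<open>x l / 2\<close> and \<open>2 * x l\<close>.\<close>
  define \<mu> where "\<mu> = Min (range x) / 4"
  have \<mu>: "\<mu> > 0" using x by (simp add: \<mu>_def)
  obtain e D where e: "0 < e" "e < \<mu>" and
    D: "D < 4 * sqrt ((\<Prod>l\<in>UNIV. x l) * (1 + (\<Sum>l\<in>UNIV. x l)))"
    "\<And>\<psi>. (\<Sum>n<4. vol_density x ?m
        (e * cos (\<psi> + real n * (pi / 2))) (e * sin (\<psi> + real n * (pi / 2)))) \<le> D"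
    using vol_density_rotation_sum[OF d x uns \<mu>] by blast
  have ex: "4 * e < x l" for l
  proof -
    have "Min (range x) \<le> x l" by (rule Min_le) auto
    then show ?thesis using e(2) unfolding \<mu>_def by linarith
  qed
  have m1: "\<bar>?m l\<bar> \<le> 1" for l by (simp add: resonance_def)
  have small: "\<bar>2 * ?m l * a\<bar> \<le> 2 * e" if "\<bar>a\<bar> \<le> e" for l a
    using mult_mono[OF m1[of l] that] e(1) by (simp add: abs_mult)
  interpret wave x ?m e
  proof
    fix a l assume "\<bar>a\<bar> \<le> \<bar>e\<bar>"
    then show "0 < x l + 2 * ?m l * a" using small[of a l] ex[of l] e(1) by linarith
  qed
  define u where "u = (\<lambda>z :: complex ^ 'n. sgn (z $ i) * cnj (sgn (z $ j)) * cnj (sgn (z $ k)))"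
  define G where "G = (\<lambda>z. e * Im (u z))"
  define W where "W = {z :: complex ^ 'n. z $ i \<noteq> 0 \<and> z $ j \<noteq> 0 \<and> z $ k \<noteq> 0}"
  define K where "K = {z :: complex ^ 'n. \<forall>l. sqrt (x l / 2) \<le> norm (z $ l) \<and> norm (z $ l) \<le> sqrt (2 * x l)}"
  define \<rho> where "\<rho> = (\<lambda>t w l. sqrt (x l + 2 * ?m l * (t * (e * Re (u w)))))"
  define y where "y = (\<lambda>t w. \<chi> l. \<rho> t w l *\<^sub>R sgn (w $ l))"
  define y' where "y' = (\<lambda>t w. \<chi> l. (?m l * (e * Re (u w)) / \<rho> t w l) *\<^sub>R sgn (w $ l))"
  have W: "open W"
    unfolding W_def by (intro open_Collect_conj open_Collect_neq continuous_intros)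
  have GC: "C_k_on n W G" for n
  proof -
    have s: "C_k_on n W (\<lambda>z. sgn (z $ l))" if "l \<in> {i, j, k}" for l
      by (rule C_k_on_sgn[OF W _ C_k_on_nth[OF W C_k_on_id[OF W]]]) (use that in \<open>auto simp: W_def\<close>)
    have c: "C_k_on n W (\<lambda>z. cnj (sgn (z $ l)))" if "l \<in> {i, j, k}" for l
      by (rule C_k_on_linear[OF W bounded_linear_cnj s[OF that]])
    have "C_k_on n W u"
      unfolding u_def by (intro C_k_on_mult[OF W] s c) auto
    then have "C_k_on n W (\<lambda>z. Im (u z))"
      by (rule C_k_on_linear[OF W bounded_linear_Im])
    then show ?thesis
      unfolding G_def by (intro C_k_on_mult[OF W] C_k_on_const)
  qed
  have K: "compact K" unfolding K_def by (rule compact_polyannulus)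
  have K0: "z $ l \<noteq> 0" if "z \<in> K" for z l
  proof -
    have "\<forall>l. sqrt (x l / 2) \<le> norm (z $ l) \<and> norm (z $ l) \<le> sqrt (2 * x l)"
      using that unfolding K_def by blast
    from spec[OF this, of l] show ?thesis using x[of l] by auto
  qed
  then have KW: "K \<subseteq> W" by (auto simp: W_def)
  have dG: "frechet_derivative G (at z) h =
      (\<Sum>l\<in>UNIV. ?m l * (e * Re (u z)) * (Im (cnj (sgn (z $ l)) * h $ l) / norm (z $ l)))" if "z \<in> W" for z h
  proof -
    define Dl where "Dl = (\<lambda>l h. Im (cnj (sgn (z $ l)) * h $ l) / norm (z $ l))"
    have s: "((\<lambda>z. sgn (z $ l)) has_derivative (\<lambda>h. Dl l h *\<^sub>R (\<i> * sgn (z $ l)))) (at z)"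
      if "l \<in> {i, j, k}" for l
      unfolding Dl_def
      by (rule has_derivative_compose[OF bounded_linear_imp_has_derivative[OF bounded_linear_vec_nth] sgn_has_derivative])
         (use that \<open>z \<in> W\<close> in \<open>auto simp: W_def\<close>)
    have c: "((\<lambda>z. cnj (sgn (z $ l))) has_derivative (\<lambda>h. cnj (Dl l h *\<^sub>R (\<i> * sgn (z $ l))))) (at z)"
      if "l \<in> {i, j, k}" for l
      by (rule bounded_linear.has_derivative[OF bounded_linear_cnj s[OF that]])
    have "(u has_derivative (\<lambda>h. (Dl i h - Dl j h - Dl k h) *\<^sub>R (\<i> * u z))) (at z)"
      unfolding u_def
      by (rule has_derivative_eq_rhs[OF has_derivative_mult[OF has_derivative_mult[OF s c] c]])
         (auto simp: fun_eq_iff scaleR_conv_of_real algebra_simps)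
    then have "((\<lambda>z. Im (u z)) has_derivative (\<lambda>h. Im ((Dl i h - Dl j h - Dl k h) *\<^sub>R (\<i> * u z)))) (at z)"
      by (rule bounded_linear.has_derivative[OF bounded_linear_Im])
    then have "(G has_derivative (\<lambda>h. e * Im ((Dl i h - Dl j h - Dl k h) *\<^sub>R (\<i> * u z)))) (at z)"
      unfolding G_def by (rule has_derivative_mult_right)
    from fun_cong[OF frechet_derivative_at[OF this], of h]
    have "frechet_derivative G (at z) h = e * ((Dl i h - Dl j h - Dl k h) * Re (u z))"
      by simp
    also have "\<dots> = (\<Sum>l\<in>UNIV. ?m l * (e * Re (u z)) * Dl l h)"
      by (subst sum_three[OF d]) (use d in \<open>auto simp: resonance_def algebra_simps\<close>)
    finally show ?thesis by (simp add: Dl_def)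
  qed
  have u1: "\<bar>Re (u w)\<bar> \<le> 1" for w
  proof -
    have "norm (u w) \<le> 1" unfolding u_def by (simp add: norm_mult norm_sgn)
    then show ?thesis using abs_Re_le_cmod order_trans by blast
  qed
  have rad: "x l / 2 \<le> x l + 2 * ?m l * (t * (e * Re (u w)))" "x l + 2 * ?m l * (t * (e * Re (u w))) \<le> 2 * x l"
    if "t \<in> {0..1}" for t w l
  proof -
    have "\<bar>t * Re (u w)\<bar> \<le> 1"
      unfolding abs_mult using that u1[of w] by (intro mult_le_one) auto
    then have "\<bar>t * (e * Re (u w))\<bar> \<le> e"
      using mult_left_mono[of "\<bar>t * Re (u w)\<bar>" 1 e] e(1) by (simp add: abs_mult mult_ac)
    from small[OF this, of l] ex[of l] x[of l]
    show "x l / 2 \<le> x l + 2 * ?m l * (t * (e * Re (u w)))" "x l + 2 * ?m l * (t * (e * Re (u w))) \<le> 2 * x l"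
      by linarith+
  qed
  have \<rho>: "\<rho> t w l > 0" if "t \<in> {0..1}" for t w l
    using rad(1)[OF that, of l w] x[of l] by (simp add: \<rho>_def)
  have Tw: "w $ l \<noteq> 0 \<and> r l *\<^sub>R sgn (w $ l) = w $ l" if "w \<in> torus r" for w l
  proof -
    from that obtain \<theta> where "w = (\<chi> i. of_real (r i) * cis (\<theta> i))"
      unfolding torus_def by blast
    then show ?thesis
      using r[of l] by (simp add: sgn_mult sgn_of_real scaleR_conv_of_real)
  qed
  have ys: "sgn (y t w $ l) = sgn (w $ l) \<and> norm (y t w $ l) = \<rho> t w l" if "w \<in> torus r" "t \<in> {0..1}" for t w l
    using \<rho>[OF that(2), of w l] Tw[OF that(1), of l] by (simp add: y_def sgn_scaleR norm_sgn)
  obtain \<Psi> where \<Psi>: "\<Psi> \<in> Ham_c" "\<And>w. w \<in> torus r \<Longrightarrow> \<Psi> (flat_to_hyp w) = flat_to_hyp (y 1 w)"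
  proof (rule hamiltonian_extension[OF W GC K KW, of "torus r" y y'])
    fix w assume w: "w \<in> torus r"
    show "y 0 w = w"
      using Tw[OF w] r by (simp add: y_def \<rho>_def x_def vec_eq_iff less_imp_le)
    fix t :: real assume t: "t \<in> {0..1}"
    show yK: "y t w \<in> K"
      unfolding K_def using ys[OF w t] rad[OF t] by (simp add: \<rho>_def)
    show "((\<lambda>s. y s w) has_vector_derivative y' t w) (at t within {0..1})"
      unfolding y_def y'_def
    proof (rule has_vector_derivative_vec_lambda)
      fix l
      let ?c = "e * Re (u w)"
      have "((\<lambda>t. x l + 2 * ?m l * (t * ?c)) has_real_derivative 2 * ?m l * ?c) (at t within {0..1})"
        by (auto intro!: derivative_eq_intros)
      moreover have "((\<lambda>X. sqrt X) has_real_derivative inverse (\<rho> t w l) / 2) (at (x l + 2 * ?m l * (t * ?c)))"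
        using DERIV_real_sqrt[of "x l + 2 * ?m l * (t * ?c)"] \<rho>[OF t, of w l] by (simp add: \<rho>_def)
      ultimately have "((\<lambda>t. \<rho> t w l) has_real_derivative inverse (\<rho> t w l) / 2 * (2 * ?m l * ?c)) (at t within {0..1})"
        unfolding \<rho>_def by (rule DERIV_chain2[rotated])
      then have "((\<lambda>t. \<rho> t w l) has_real_derivative ?m l * ?c / \<rho> t w l) (at t within {0..1})"
        by (simp add: inverse_eq_divide)
      from has_vector_derivative_scaleR[OF this has_vector_derivative_const]
      show "((\<lambda>t. \<rho> t w l *\<^sub>R sgn (w $ l)) has_vector_derivative
          (?m l * ?c / \<rho> t w l) *\<^sub>R sgn (w $ l)) (at t within {0..1})"
        by simp
    qed
    fix h
    have "u (y t w) = u w" using ys[OF w t] by (simp add: u_def)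
    then show "flat_form (y' t w) h = frechet_derivative G (at (y t w)) h"
      using dG[of "y t w" h] yK KW ys[OF w t] by (auto simp: flat_form_sum y'_def)
  qed blast
  have image: "\<Psi> ` hyp_torus r = (\<lambda>\<theta>. flat_to_hyp (wave_torus x ?m e \<theta>)) ` angle_box"
  proof -
    have "\<Psi> (flat_to_hyp (wave_torus x ?m 0 \<theta>)) = flat_to_hyp (wave_torus x ?m e \<theta>)" if "\<theta> \<in> angle_box" for \<theta>
    proof -
      let ?w = "wave_torus x ?m 0 \<theta>"
      have "?w \<in> torus r" using that torus_eq[OF r, where m = ?m] by (auto simp: x_def)
      moreover have s: "sgn (?w $ l) = cis (\<theta> $ l)" for l
        using x[of l] by (simp add: wave_torus_def sgn_mult sgn_of_real)
      have "phase ?m \<theta> = \<theta> $ i - \<theta> $ j - \<theta> $ k"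
        unfolding phase_def by (subst sum_three[OF d]) (use d in \<open>auto simp: resonance_def\<close>)
      then have u: "u ?w = cis (phase ?m \<theta>)"
        by (simp add: u_def s cis_cnj cis_mult)
      have "y 1 ?w = wave_torus x ?m e \<theta>"
        unfolding y_def s \<rho>_def u by (simp add: wave_torus_def scaleR_conv_of_real)
      ultimately show ?thesis using \<Psi>(2) by simp
    qed
    then show ?thesis
      unfolding hyp_torus_eq[OF r] torus_eq[OF r, where m = ?m] x_def[symmetric] image_image
      by (intro image_cong) auto
  qed
  let ?f = "\<lambda>\<theta>. vol_density x ?m (e * cos (phase ?m \<theta>)) (e * sin (phase ?m \<theta>))"
  have "(\<integral>\<^sup>+\<theta>\<in>angle_box. ennreal (?f \<theta>) \<partial>lborel) <
      (\<integral>\<^sup>+\<theta>\<in>(angle_box :: (real ^ 'n) set). ennreal (sqrt ((\<Prod>l\<in>UNIV. x l) * (1 + (\<Sum>l\<in>UNIV. x l)))) \<partial>lborel)"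
  proof (rule nn_integral_angle_box_less[OF _ _ _ D(1)])
    show "?f \<in> borel_measurable borel"
      unfolding vol_density_def Let_def phase_def by measurable
    show "0 \<le> ?f \<theta>" for \<theta>
      by (rule vol_density_nonneg)
    have "phase ?m (\<theta> + axis i t) = phase ?m \<theta> + t" for \<theta> t
      using linear_add[OF bounded_linear.linear[OF phase_linear[of ?m]], of \<theta> "axis i t"]
      by (simp add: phase_axis resonance_def)
    then show "(\<Sum>n<4. ?f (\<theta> + axis i (real n * (pi / 2)))) \<le> D" for \<theta>
      using D(2)[of "phase ?m \<theta>"] by simp
  qed
  moreover have "has_volume (hyp_torus r) (\<integral>\<^sup>+\<theta>\<in>(angle_box :: (real ^ 'n) set).
      ennreal (sqrt ((\<Prod>l\<in>UNIV. x l) * (1 + (\<Sum>l\<in>UNIV. x l)))) \<partial>lborel)"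
    unfolding x_def by (rule has_volume_hyp_torus[OF r])
  moreover have "has_volume (\<Psi> ` hyp_torus r) (\<integral>\<^sup>+\<theta>\<in>angle_box. ennreal (?f \<theta>) \<partial>lborel)"
    unfolding image by (rule has_volume_wave)
  ultimately show ?thesis
    by (intro not_minimizingI[OF \<Psi>(1)])
qed

section \<open>Tori with three different radii\<close>

text \<open>The rotation exchanges the discs of \<open>z\<^sub>i\<close> and
  \<open>z\<^sub>j\<close> in the symplectic coordinates in which \<open>z\<^sub>j\<close> is
  twisted by the phase of \<open>z\<^sub>k\<close>. The action conjugate to that phase is
  \<open>(|z\<^sub>k|\<^sup>2 - |z\<^sub>j|\<^sup>2) / 2\<close>, which is therefore conserved. It
  is positive because \<open>r\<^sub>j < r\<^sub>k\<close>, and this keeps \<open>z\<^sub>k\<close>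
  away from \<open>0\<close> during the motion.\<close>
lemma not_minimizing_of_three_radii:
  fixes r :: "'n::finite \<Rightarrow> real"
  assumes r: "\<And>l. r l > 0" and ij: "r i < r j" and jk: "r j < r k"
  shows "\<not> hamiltonian_volume_minimizing (hyp_torus r)"
proof -
  have d: "i \<noteq> j" "j \<noteq> k" "i \<noteq> k" using ij jk by auto
  \<comment> \<open>The conserved quantity \<open>|z\<^sub>k|\<^sup>2 - |z\<^sub>j|\<^sup>2\<close>.\<close>
  define q where "q = (r k)\<^sup>2 - (r j)\<^sup>2"
  have q: "q > 0" unfolding q_def using r[of j] jk by (simp add: power_strict_mono less_imp_le)
  define r' where "r' = r(i := r j, j := r i, k := sqrt (q + (r i)\<^sup>2))"
  have r': "r' l > 0" for l using r q by (simp add: r'_def add_pos_nonneg)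
  define W where "W = {z :: complex ^ 'n. z $ k \<noteq> 0}"
  define G where "G = (\<lambda>z :: complex ^ 'n. pi / 2 * Im (cnj (z $ i) * z $ j * sgn (z $ k)))"
  define R where "R = (\<lambda>l. if l = k then sqrt (q + (r i + r j)\<^sup>2) else if l = i \<or> l = j then r i + r j else r l)"
  define K where "K = {z :: complex ^ 'n. \<forall>l. (if l = k then sqrt q else 0) \<le> norm (z $ l) \<and> norm (z $ l) \<le> R l}"
  define c where "c = (\<lambda>t. cos (pi / 2 * t))"
  define s where "s = (\<lambda>t. sin (pi / 2 * t))"
  \<comment> \<open>The phase \<open>\<epsilon>\<close> is constant in time; \<open>(P, Q)\<close> is the rotated pair \<open>(z\<^sub>i, z\<^sub>j \<epsilon>)\<close>.\<close>
  define \<epsilon> where "\<epsilon> = (\<lambda>w :: complex ^ 'n. sgn (w $ k))"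
  define P where "P = (\<lambda>t w. c t *\<^sub>R (w $ i) - s t *\<^sub>R (w $ j * \<epsilon> w))"
  define Q where "Q = (\<lambda>t w. s t *\<^sub>R (w $ i) + c t *\<^sub>R (w $ j * \<epsilon> w))"
  define \<rho> where "\<rho> = (\<lambda>t w. sqrt (q + Q t w \<bullet> Q t w))"
  define y where "y = (\<lambda>t w. \<chi> l. if l = i then P t w else if l = j then Q t w * cnj (\<epsilon> w)
      else if l = k then \<rho> t w *\<^sub>R \<epsilon> w else w $ l)"
  define y' where "y' = (\<lambda>t w. \<chi> l. if l = i then - (pi / 2) *\<^sub>R Q t w
      else if l = j then ((pi / 2) *\<^sub>R P t w) * cnj (\<epsilon> w)
      else if l = k then (pi / 2 * (P t w \<bullet> Q t w) / \<rho> t w) *\<^sub>R \<epsilon> w else 0)"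
  have W: "open W"
    unfolding W_def by (intro open_Collect_neq continuous_intros)
  have GC: "C_k_on n W G" for n
  proof -
    have z: "C_k_on n W (\<lambda>z. z $ l)" for l
      by (rule C_k_on_nth[OF W C_k_on_id[OF W]])
    have "C_k_on n W (\<lambda>z. cnj (z $ i) * z $ j * sgn (z $ k))"
      by (intro C_k_on_mult[OF W] z C_k_on_linear[OF W bounded_linear_cnj z] C_k_on_sgn[OF W _ z])
         (simp add: W_def)
    then have "C_k_on n W (\<lambda>z. Im (cnj (z $ i) * z $ j * sgn (z $ k)))"
      by (rule C_k_on_linear[OF W bounded_linear_Im])
    then show ?thesis
      unfolding G_def by (intro C_k_on_mult[OF W] C_k_on_const)
  qed
  have K: "compact K" unfolding K_def by (rule compact_polyannulus)
  have KW: "K \<subseteq> W"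
  proof
    fix z assume "z \<in> K"
    then have "\<forall>l. (if l = k then sqrt q else 0) \<le> norm (z $ l) \<and> norm (z $ l) \<le> R l"
      unfolding K_def by blast
    from spec[OF this, of k] show "z \<in> W" using q by (auto simp: W_def)
  qed
  have dG: "frechet_derivative G (at z) h = pi / 2 * (Im (cnj (- (z $ j * sgn (z $ k))) * h $ i) +
      Im (cnj (z $ i * cnj (sgn (z $ k))) * h $ j) +
      (z $ i \<bullet> (z $ j * sgn (z $ k))) * (Im (cnj (sgn (z $ k)) * h $ k) / norm (z $ k)))" if "z \<in> W" for z h
  proof -
    define D where "D = (\<lambda>h. Im (cnj (sgn (z $ k)) * h $ k) / norm (z $ k))"
    have n: "((\<lambda>z. z $ l) has_derivative (\<lambda>h. h $ l)) (at z)" for l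
      by (rule bounded_linear_imp_has_derivative[OF bounded_linear_vec_nth])
    have sg: "((\<lambda>z. sgn (z $ k)) has_derivative (\<lambda>h. D h *\<^sub>R (\<i> * sgn (z $ k)))) (at z)"
      unfolding D_def by (rule has_derivative_compose[OF n sgn_has_derivative]) (use that in \<open>simp add: W_def\<close>)
    have "((\<lambda>z. cnj (z $ i) * z $ j * sgn (z $ k)) has_derivative
        (\<lambda>h. cnj (z $ i) * z $ j * (D h *\<^sub>R (\<i> * sgn (z $ k))) +
          (cnj (z $ i) * h $ j + cnj (h $ i) * z $ j) * sgn (z $ k))) (at z)"
      by (intro has_derivative_mult n sg bounded_linear.has_derivative[OF bounded_linear_cnj n])
    from has_derivative_mult_right[OF bounded_linear.has_derivative[OF bounded_linear_Im this]]
    have "(G has_derivative (\<lambda>h. pi / 2 * Im (cnj (z $ i) * z $ j * (D h *\<^sub>R (\<i> * sgn (z $ k))) +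
          (cnj (z $ i) * h $ j + cnj (h $ i) * z $ j) * sgn (z $ k)))) (at z)"
      unfolding G_def .
    from fun_cong[OF frechet_derivative_at[OF this], of h]
    have "frechet_derivative G (at z) h = pi / 2 * Im (cnj (z $ i) * z $ j * (D h *\<^sub>R (\<i> * sgn (z $ k))) +
          (cnj (z $ i) * h $ j + cnj (h $ i) * z $ j) * sgn (z $ k))"
      by (rule sym)
    also have "\<dots> = pi / 2 * (Im (cnj (- (z $ j * sgn (z $ k))) * h $ i) +
        Im (cnj (z $ i * cnj (sgn (z $ k))) * h $ j) + (z $ i \<bullet> (z $ j * sgn (z $ k))) * D h)"
      by (simp add: inner_complex_def algebra_simps)
    finally show ?thesis by (simp add: D_def)
  qed
  have Tn: "norm (w $ l) = r l" if "w \<in> torus r" for w l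
    using that r[of l] unfolding torus_def by (auto simp: norm_mult)
  have \<epsilon>: "norm (\<epsilon> w) = 1" "\<epsilon> w * cnj (\<epsilon> w) = 1" if "w \<in> torus r" for w
  proof -
    show "norm (\<epsilon> w) = 1" using Tn[OF that, of k] r[of k] by (auto simp: \<epsilon>_def norm_sgn)
    then show "\<epsilon> w * cnj (\<epsilon> w) = 1" by (simp add: complex_norm_square[symmetric])
  qed
  have \<rho>: "\<rho> t w > 0" for t w
    unfolding \<rho>_def using q by (simp add: add_pos_nonneg)
  have cs: "\<bar>c t\<bar> \<le> 1" "\<bar>s t\<bar> \<le> 1" for t
    by (simp_all add: c_def s_def)
  have PQ: "norm (P t w) \<le> r i + r j" "norm (Q t w) \<le> r i + r j" if w: "w \<in> torus r" for t w
  proof -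
    have b: "\<bar>a\<bar> * r l \<le> r l" if "\<bar>a\<bar> \<le> 1" for a l
      using mult_right_mono[OF that, of "r l"] r[of l] by simp
    have n: "norm (a *\<^sub>R (w $ i)) \<le> r i" "norm (a *\<^sub>R (w $ j * \<epsilon> w)) \<le> r j" if "\<bar>a\<bar> \<le> 1" for a
      using b[OF that] by (simp_all add: norm_mult Tn[OF w] \<epsilon>[OF w])
    show "norm (P t w) \<le> r i + r j"
      unfolding P_def by (rule order_trans[OF norm_triangle_ineq4 add_mono[OF n(1)[OF cs(1)] n(2)[OF cs(2)]]])
    show "norm (Q t w) \<le> r i + r j"
      unfolding Q_def by (rule norm_triangle_le[OF add_mono[OF n(1)[OF cs(2)] n(2)[OF cs(1)]]])
  qed
  obtain \<Psi> where \<Psi>: "\<Psi> \<in> Ham_c" "\<And>w. w \<in> torus r \<Longrightarrow> \<Psi> (flat_to_hyp w) = flat_to_hyp (y 1 w)"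
  proof (rule hamiltonian_extension[OF W GC K KW, of "torus r" y y'])
    fix w assume w: "w \<in> torus r"
    have k: "r k *\<^sub>R \<epsilon> w = w $ k"
      using Tn[OF w, of k] r[of k] by (auto simp: \<epsilon>_def sgn_div_norm)
    have Q0: "Q 0 w \<bullet> Q 0 w = (r j)\<^sup>2"
      by (simp add: Q_def c_def s_def dot_square_norm norm_mult Tn[OF w] \<epsilon>[OF w])
    have rho0: "\<rho> 0 w = r k"
      using r[of k] by (simp add: \<rho>_def Q0 q_def less_imp_le)
    show "y 0 w = w"
      using d k \<epsilon>(2)[OF w] by (simp add: y_def vec_eq_iff rho0) (simp add: P_def Q_def c_def s_def mult.assoc)
    fix t :: real assume t: "t \<in> {0..1}"
    have Qb: "Q t w \<bullet> Q t w \<le> (r i + r j)\<^sup>2"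
      unfolding dot_square_norm using PQ(2)[OF w] by (intro power_mono) auto
    show yK: "y t w \<in> K"
      unfolding K_def mem_Collect_eq
    proof
      fix l
      show "(if l = k then sqrt q else 0) \<le> norm (y t w $ l) \<and> norm (y t w $ l) \<le> R l"
        using d Qb PQ[OF w, of t] q by (auto simp: y_def R_def norm_mult \<epsilon>[OF w] Tn[OF w] \<rho>_def)
    qed
    have dP: "((\<lambda>t. P t w) has_vector_derivative - (pi / 2) *\<^sub>R Q t w) (at t within {0..1})"
      unfolding P_def Q_def c_def s_def
      by (auto intro!: derivative_eq_intros simp: algebra_simps)
    have dQ: "((\<lambda>t. Q t w) has_vector_derivative (pi / 2) *\<^sub>R P t w) (at t within {0..1})"
      unfolding P_def Q_def c_def s_def
      by (auto intro!: derivative_eq_intros simp: algebra_simps)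
    have dQQ: "((\<lambda>t. q + Q t w \<bullet> Q t w) has_real_derivative pi * (P t w \<bullet> Q t w)) (at t within {0..1})"
    proof -
      have "((\<lambda>t. q + Q t w \<bullet> Q t w) has_derivative
          (\<lambda>h. 0 + (Q t w \<bullet> (h *\<^sub>R ((pi / 2) *\<^sub>R P t w)) + (h *\<^sub>R ((pi / 2) *\<^sub>R P t w)) \<bullet> Q t w))) (at t within {0..1})"
        using dQ unfolding has_vector_derivative_def
        by (intro has_derivative_add has_derivative_const has_derivative_inner)
      then show ?thesis
        unfolding has_field_derivative_def
        by (rule has_derivative_eq_rhs) (simp add: fun_eq_iff inner_commute)
    qed
    have d\<rho>: "((\<lambda>t. \<rho> t w) has_real_derivative pi / 2 * (P t w \<bullet> Q t w) / \<rho> t w) (at t within {0..1})"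
    proof -
      have "((\<lambda>X. sqrt X) has_real_derivative inverse (\<rho> t w) / 2) (at (q + Q t w \<bullet> Q t w))"
        using DERIV_real_sqrt[of "q + Q t w \<bullet> Q t w"] \<rho>[of t w] by (simp add: \<rho>_def)
      from DERIV_chain2[OF this dQQ]
      have "((\<lambda>t. \<rho> t w) has_real_derivative inverse (\<rho> t w) / 2 * (pi * (P t w \<bullet> Q t w))) (at t within {0..1})"
        by (simp only: \<rho>_def)
      then show ?thesis by (simp add: inverse_eq_divide mult.commute[of 2])
    qed
    show "((\<lambda>s. y s w) has_vector_derivative y' t w) (at t within {0..1})"
      unfolding y_def y'_def
    proof (rule has_vector_derivative_vec_lambda)
      fix l
      show "((\<lambda>t. if l = i then P t w else if l = j then Q t w * cnj (\<epsilon> w)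
          else if l = k then \<rho> t w *\<^sub>R \<epsilon> w else w $ l) has_vector_derivative
        (if l = i then - (pi / 2) *\<^sub>R Q t w else if l = j then ((pi / 2) *\<^sub>R P t w) * cnj (\<epsilon> w)
          else if l = k then (pi / 2 * (P t w \<bullet> Q t w) / \<rho> t w) *\<^sub>R \<epsilon> w else 0)) (at t within {0..1})"
        using dP has_vector_derivative_mult_left[OF dQ, of "cnj (\<epsilon> w)"]
          has_vector_derivative_scaleR[OF d\<rho> has_vector_derivative_const, of "\<epsilon> w"]
        by simp
    qed
    fix h
    have c1: "y t w $ i = P t w" "y t w $ j = Q t w * cnj (\<epsilon> w)" "y t w $ k = \<rho> t w *\<^sub>R \<epsilon> w"
      using d by (simp_all add: y_def)
    have c2: "sgn (y t w $ k) = \<epsilon> w" "norm (y t w $ k) = \<rho> t w"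
      using \<rho>[of t w] \<epsilon>[OF w] by (simp_all add: c1 sgn_scaleR) (simp_all add: sgn_div_norm)
    have c3: "y t w $ j * \<epsilon> w = Q t w"
      unfolding c1 using \<epsilon>(2)[OF w] by (simp add: mult.assoc mult.commute)
    have "flat_form (y' t w) h = Im (cnj (- (pi / 2) *\<^sub>R Q t w) * h $ i) +
        Im (cnj (((pi / 2) *\<^sub>R P t w) * cnj (\<epsilon> w)) * h $ j) +
        Im (cnj ((pi / 2 * (P t w \<bullet> Q t w) / \<rho> t w) *\<^sub>R \<epsilon> w) * h $ k)"
      unfolding flat_form_sum
      by (subst sum_three[OF d]) (use d in \<open>simp_all add: y'_def\<close>)
    also have "\<dots> = pi / 2 * (Im (cnj (- Q t w) * h $ i) + Im (cnj (P t w * cnj (\<epsilon> w)) * h $ j) +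
        (P t w \<bullet> Q t w) * (Im (cnj (\<epsilon> w) * h $ k) / \<rho> t w))"
      by (simp add: algebra_simps add_divide_distrib diff_divide_distrib)
    also have "\<dots> = frechet_derivative G (at (y t w)) h"
      using dG[of "y t w" h] yK KW unfolding c2 c3 c1(1) by auto
    finally show "flat_form (y' t w) h = frechet_derivative G (at (y t w)) h" .
  qed blast
  have image: "y 1 ` torus r = torus r'"
  proof -
    have y1: "y 1 (\<chi> l. of_real (r l) * cis (\<theta> l)) = (\<chi> l. of_real (r' l) *
        cis ((\<theta>(i := \<theta> j + \<theta> k + pi, j := \<theta> i - \<theta> k)) l))" for \<theta>
    proof -
      let ?w = "\<chi> l. of_real (r l) * cis (\<theta> l) :: complex ^ 'n"
      have e: "\<epsilon> ?w = cis (\<theta> k)" using r[of k] by (simp add: \<epsilon>_def sgn_mult sgn_of_real)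
      have P1: "P 1 ?w = of_real (r j) * cis (\<theta> j + \<theta> k + pi)"
        by (simp add: P_def c_def s_def e mult.assoc cis_mult minus_cis[symmetric])
      have Q1: "Q 1 ?w = of_real (r i) * cis (\<theta> i)"
        by (simp add: Q_def c_def s_def)
      have "Q 1 ?w \<bullet> Q 1 ?w = (r i)\<^sup>2"
        using r[of i] by (simp add: Q1 dot_square_norm norm_mult)
      then have rho1: "\<rho> 1 ?w = sqrt (q + (r i)\<^sup>2)" by (simp add: \<rho>_def)
      show ?thesis
        using d by (simp add: y_def P1 Q1 rho1 e vec_eq_iff r'_def cis_cnj cis_mult mult.assoc scaleR_conv_of_real)
    qed
    show ?thesis
    proof
      show "y 1 ` torus r \<subseteq> torus r'"
      proof
        fix z assume "z \<in> y 1 ` torus r"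
        then obtain \<theta> where "z = y 1 (\<chi> l. of_real (r l) * cis (\<theta> l))" unfolding torus_def by blast
        then show "z \<in> torus r'" unfolding y1 torus_def by blast
      qed
      show "torus r' \<subseteq> y 1 ` torus r"
      proof
        fix z assume "z \<in> torus r'"
        then obtain \<eta> where z: "z = (\<chi> l. of_real (r' l) * cis (\<eta> l))" unfolding torus_def by blast
        \<comment> \<open>The inverse of the map of angles in \<open>y1\<close>.\<close>
        define \<theta> where "\<theta> = \<eta>(i := \<eta> j + \<eta> k, j := \<eta> i - \<eta> k - pi)"
        have "\<theta>(i := \<theta> j + \<theta> k + pi, j := \<theta> i - \<theta> k) = \<eta>"
          using d by (auto simp: \<theta>_def fun_eq_iff)
        then have "z = y 1 (\<chi> l. of_real (r l) * cis (\<theta> l))" unfolding y1 z by simp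
        then show "z \<in> y 1 ` torus r" unfolding torus_def by blast
      qed
    qed
  qed
  have image': "\<Psi> ` hyp_torus r = hyp_torus r'"
    unfolding hyp_torus_eq[OF r] hyp_torus_eq[OF r'] image[symmetric] image_image
    using \<Psi>(2) by (intro image_cong) auto
  have "(\<integral>\<^sup>+\<theta>\<in>(angle_box :: (real ^ 'n) set).
        ennreal (sqrt ((\<Prod>l\<in>UNIV. (r' l)\<^sup>2) * (1 + (\<Sum>l\<in>UNIV. (r' l)\<^sup>2)))) \<partial>lborel) <
      (\<integral>\<^sup>+\<theta>\<in>(angle_box :: (real ^ 'n) set).
        ennreal (sqrt ((\<Prod>l\<in>UNIV. (r l)\<^sup>2) * (1 + (\<Sum>l\<in>UNIV. (r l)\<^sup>2)))) \<partial>lborel)"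
  proof (rule nn_integral_angle_box_less[where k = i, OF _ _ order_refl])
    \<comment> \<open>The radii after the exchange alone; they give the same volume as \<open>r\<close>.\<close>
    define f where "f = r(i := r j, j := r i)"
    have fs: "(\<Sum>l\<in>UNIV. (f l)\<^sup>2) = (\<Sum>l\<in>UNIV. (r l)\<^sup>2)"
      by (rule sum.reindex_bij_witness[where i="\<lambda>l. if l = i then j else if l = j then i else l"
            and j="\<lambda>l. if l = i then j else if l = j then i else l"]) (use d in \<open>auto simp: f_def\<close>)
    have fp: "(\<Prod>l\<in>UNIV. (f l)\<^sup>2) = (\<Prod>l\<in>UNIV. (r l)\<^sup>2)"
      by (rule prod.reindex_bij_witness[where i="\<lambda>l. if l = i then j else if l = j then i else l"
            and j="\<lambda>l. if l = i then j else if l = j then i else l"]) (use d in \<open>auto simp: f_def\<close>)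
    have "(r i)\<^sup>2 < (r j)\<^sup>2" using ij r[of i] by (simp add: power_strict_mono less_imp_le)
    moreover have "(r' k)\<^sup>2 = q + (r i)\<^sup>2" using q by (simp add: r'_def)
    ultimately have k: "(r' k)\<^sup>2 < (f k)\<^sup>2" using d by (simp add: f_def q_def)
    have le: "(r' l)\<^sup>2 \<le> (f l)\<^sup>2" for l
      using k by (cases "l = k") (auto simp: r'_def f_def)
    have S: "(\<Sum>l\<in>UNIV. (r' l)\<^sup>2) < (\<Sum>l\<in>UNIV. (r l)\<^sup>2)"
      unfolding fs[symmetric] using le k by (intro sum_strict_mono_ex1) auto
    have "(\<Prod>l\<in>UNIV. (r' l)\<^sup>2) \<le> (\<Prod>l\<in>UNIV. (r l)\<^sup>2)"
      unfolding fp[symmetric] using le by (intro prod_mono) auto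
    moreover have "(\<Prod>l\<in>UNIV. (r' l)\<^sup>2) > 0" by (intro prod_pos ballI zero_less_power r')
    ultimately have "(\<Prod>l\<in>UNIV. (r' l)\<^sup>2) * (1 + (\<Sum>l\<in>UNIV. (r' l)\<^sup>2)) <
        (\<Prod>l\<in>UNIV. (r l)\<^sup>2) * (1 + (\<Sum>l\<in>UNIV. (r l)\<^sup>2))"
      using S by (intro mult_le_less_imp_less) (auto simp: sum_nonneg add_nonneg_nonneg)
    then show "(\<Sum>n<4::nat. sqrt ((\<Prod>l\<in>UNIV. (r' l)\<^sup>2) * (1 + (\<Sum>l\<in>UNIV. (r' l)\<^sup>2)))) <
        4 * sqrt ((\<Prod>l\<in>UNIV. (r l)\<^sup>2) * (1 + (\<Sum>l\<in>UNIV. (r l)\<^sup>2)))"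
      by simp
  qed (simp_all add: sum_nonneg prod_nonneg)
  then show ?thesis
    by (rule not_minimizingI[OF \<Psi>(1) has_volume_hyp_torus[of r] _, rotated 2])
       (rule r, unfold image', rule has_volume_hyp_torus, rule r')
qed

theorem theorem4p12:
  fixes r :: "'n::finite \<Rightarrow> real"
  assumes "CARD('n) \<ge> 3"
    and "\<And>i. r i > 0"
    and "(\<exists>i j k. i \<noteq> j \<and> j \<noteq> k \<and> i \<noteq> k \<and>
            \<not> (sqrt (1 + (\<Sum>l\<in>UNIV. (r l)\<^sup>2)) * r i \<ge> r j * r k))
         \<or> card (range r) \<ge> 3"
  shows "\<not> hamiltonian_volume_minimizing (hyp_torus r)"
  using assms(3)
proof
  assume "\<exists>i j k. i \<noteq> j \<and> j \<noteq> k \<and> i \<noteq> k \<and>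
            \<not> (sqrt (1 + (\<Sum>l\<in>UNIV. (r l)\<^sup>2)) * r i \<ge> r j * r k)"
  then obtain i j k where d: "i \<noteq> j" "j \<noteq> k" "i \<noteq> k"
    and u: "sqrt (1 + (\<Sum>l\<in>UNIV. (r l)\<^sup>2)) * r i < r j * r k"
    by (auto simp: not_le)
  show ?thesis
    by (rule not_minimizing_of_unstable[OF d assms(2) u])
next
  assume "card (range r) \<ge> 3"
  then obtain S where S: "S \<subseteq> range r" "card S = 3"
    by (rule obtain_subset_with_card_n)
  then obtain a b c where abc: "S = {a, b, c}" "a \<noteq> b" "a \<noteq> c" "b \<noteq> c"
    by (auto simp: card_3_iff)
  have mem: "a \<in> range r" "b \<in> range r" "c \<in> range r" using abc(1) S(1) by auto
  have "\<exists>i j k. r i < r j \<and> r j < r k"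
  proof -
    obtain i j k where ijk: "a = r i" "b = r j" "c = r k" using mem by blast
    consider "a < b" "b < c" | "a < c" "c < b" | "b < a" "a < c" | "b < c" "c < a" | "c < a" "a < b" | "c < b" "b < a"
      using abc(2-4) by linarith
    then show ?thesis by cases (use ijk in blast)+
  qed
  then obtain i j k where "r i < r j" "r j < r k" by blast
  then show ?thesis
    by (rule not_minimizing_of_three_radii[OF assms(2)])
qed

end
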